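(* Let $\Omega\subset\mathbb R^N$, $N\ge2$, be a smooth bounded domain and let $f:\mathbb R\to[0,+\infty)$ be non-decreasing, with $f(0)>0$ and $f$ of class $C^1$ on $\{t:0<f(t)<f(0)\}$. Assume $$\lim_{t\to-\infty}f(t)=c_0>0.$$ For $\lambda<0$ let $u_\lambda$ be the unique negative solution to $$-\Delta u=\lambda f(u)\ \text{ in }\Omega,\qquad u=0\ \text{ on }\partial\Omega.$$ Then $$u_\lambda=\lambda\big(c_0+o(1)\big)\phi\quad\text{as }\lambda\to-\infty\ \text{in }C^1_{\mathrm{loc}}(\Omega),$$ where $\phi$ is the solution of the torsion problem $$-\Delta\phi=1\ \text{ in }\Omega,\qquad \phi=0\ \text{ on }\partial\Omega.$$
   Context: The expansion means that $u_\lambda/\lambda\to c_0\phi$ in $C^1_{\mathrm{loc}}(\Omega)$ as $\lambda\to-\infty$. *)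

theory Defs
  imports "HOL-Analysis.Analysis"
begin

definition partial_deriv :: "'n \<Rightarrow> (real ^ 'n \<Rightarrow> real) \<Rightarrow> real ^ 'n \<Rightarrow> real" where
  "partial_deriv i g x = frechet_derivative g (at x) (axis i 1)"

definition grad :: "(real ^ 'n \<Rightarrow> real) \<Rightarrow> real ^ 'n \<Rightarrow> real ^ 'n" where
  "grad g x = (\<chi> i. partial_deriv i g x)"

(* Ck_on k S g: g is of class C^k on S; intended for open S. *)
primrec Ck_on :: "nat \<Rightarrow> (real ^ 'n) set \<Rightarrow> (real ^ 'n \<Rightarrow> real) \<Rightarrow> bool" where
  "Ck_on 0 S g \<longleftrightarrow> continuous_on S g"
| "Ck_on (Suc k) S g \<longleftrightarrow>
     (\<forall>x\<in>S. g differentiable at x) \<and> (\<forall>i. Ck_on k S (partial_deriv i g))"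

(* One-variable C^1 regularity on a set that need not be open: derivatives are taken within the
   set, so they are one-sided at an endpoint belonging to A. On an open A this is the usual C^1. *)
definition C1_within :: "real set \<Rightarrow> (real \<Rightarrow> real) \<Rightarrow> bool" where
  "C1_within A f \<longleftrightarrow>
     (\<exists>f'. (\<forall>t\<in>A. (f has_real_derivative f' t) (at t within A)) \<and> continuous_on A f')"

(* Near each boundary point the domain is a sublevel set of a C^infinity function without
   critical points; by the implicit function theorem this says that the boundary is locally a
   smooth graph with the domain on one side of it. *)
definition smooth_bounded_domain :: "(real ^ 'n) set \<Rightarrow> bool" where
  "smooth_bounded_domain \<Omega> \<longleftrightarrow>
     open \<Omega> \<and> connected \<Omega> \<and> \<Omega> \<noteq> {} \<and> bounded \<Omega> \<and>
     (\<forall>p\<in>frontier \<Omega>. \<exists>U \<rho>. open U \<and> p \<in> U \<and> (\<forall>k. Ck_on k U \<rho>) \<and>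
        (\<forall>x\<in>U. grad \<rho> x \<noteq> 0) \<and> \<Omega> \<inter> U = {x \<in> U. \<rho> x < 0})"

definition test_function :: "(real ^ 'n) set \<Rightarrow> (real ^ 'n \<Rightarrow> real) \<Rightarrow> bool" where
  "test_function \<Omega> \<psi> \<longleftrightarrow>
     Ck_on 1 UNIV \<psi> \<and> compact (closure {x. \<psi> x \<noteq> 0}) \<and> closure {x. \<psi> x \<noteq> 0} \<subseteq> \<Omega>"

(* v solves -Laplace v = g in \<Omega>, v = 0 on the boundary. The equation is understood weakly,
   since the right-hand side may be discontinuous (the nonlinearity is only assumed monotone
   and C^1 on a part of the line); C^2 solutions are included by integration by parts.
   Local integrability of g keeps the integrals from taking their default value 0. *)
definition dirichlet_solution ::
    "(real ^ 'n) set \<Rightarrow> (real ^ 'n \<Rightarrow> real) \<Rightarrow> (real ^ 'n \<Rightarrow> real) \<Rightarrow> bool" where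
  "dirichlet_solution \<Omega> g v \<longleftrightarrow>
     Ck_on 1 \<Omega> v \<and> continuous_on (closure \<Omega>) v \<and> (\<forall>x\<in>frontier \<Omega>. v x = 0) \<and>
     (\<forall>K. compact K \<and> K \<subseteq> \<Omega> \<longrightarrow> set_integrable lebesgue K g) \<and>
     (\<forall>\<psi>. test_function \<Omega> \<psi> \<longrightarrow>
        (LINT x:\<Omega>|lebesgue. grad v x \<bullet> grad \<psi> x) = (LINT x:\<Omega>|lebesgue. g x * \<psi> x))"

definition negative_solution ::
    "(real ^ 'n) set \<Rightarrow> (real \<Rightarrow> real) \<Rightarrow> real \<Rightarrow> (real ^ 'n \<Rightarrow> real) \<Rightarrow> bool" where
  "negative_solution \<Omega> f l v \<longleftrightarrow>
     dirichlet_solution \<Omega> (\<lambda>x. l * f (v x)) v \<and> (\<forall>x\<in>\<Omega>. v x < 0)"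

definition tendsto_C1_loc ::
    "(real ^ 'n) set \<Rightarrow> ('s \<Rightarrow> real ^ 'n \<Rightarrow> real) \<Rightarrow> (real ^ 'n \<Rightarrow> real) \<Rightarrow> 's filter \<Rightarrow> bool" where
  "tendsto_C1_loc \<Omega> v w F \<longleftrightarrow>
     (\<forall>\<^sub>F s in F. Ck_on 1 \<Omega> (v s)) \<and> Ck_on 1 \<Omega> w \<and>
     (\<forall>K. compact K \<and> K \<subseteq> \<Omega> \<longrightarrow>
        uniform_limit K v w F \<and> uniform_limit K (\<lambda>s. grad (v s)) (grad w) F)"

end

theory Submission
  imports Defs
begin

text \<open>
  Write $w_\<lambda> = u_\<lambda> / \<lambda> > 0$ and $v_\<lambda> = w_\<lambda> - c_0 \<phi>$. Then $-\<Delta> v_\<lambda> = h_\<lambda> := f(u_\<lambda>) - c_0$ with zero boundary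
  values. Since $f$ is non-decreasing with limit $c_0$ at $-\infty$ and $u_\<lambda> < 0$, one has
  $0 \<le> h_\<lambda> \<le> M$ for a constant $M > 0$, and two comparisons give $0 \<le> v_\<lambda> \<le> M \<phi>$. The lower bound says
  $u_\<lambda> \<le> \<lambda> c_0 \<phi>$, so that $u_\<lambda> \<rightarrow> -\infty$ and hence $h_\<lambda> \<rightarrow> 0$ uniformly on every set on which $\<phi>$ is
  bounded away from zero. The upper bound confines $\{v_\<lambda> > \<eta>\}$ to such a set, namely $\{\<phi> > \<eta>/M\}$, and
  comparison with $\<delta> \<phi> + \<eta>$ shows that $v_\<lambda> \<rightarrow> 0$ uniformly on the whole domain.

  Convergence of the gradients on compact sets follows from an interior estimate that bounds
  $|\<nabla> v(p)|$ by the suprema of $|v|$ and $|\<Delta> v|$ on a cube about $p$ (lemma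
  \<open>interior_gradient_bound\<close>). On a compact set the supremum of $h_\<lambda>$ also tends to zero, because $\<phi>$ is
  positive inside the domain (lemma \<open>torsion_function_positive\<close>) and thus bounded away from zero there.

  All of this rests on a single tool, the maximum principle for weak solutions of class $C^1$ (lemma
  \<open>weak_maximum_principle\<close>), applied to linear combinations of solutions, of reflected solutions, and of
  quadratic polynomials. Its proof is elementary because the solutions are $C^1$: the square of the
  positive part of a $C^1$ function is again $C^1$, so it can serve as a test function.
\<close>

section \<open>Gradients of continuously differentiable functions\<close>

lemma grad_eqI:
  assumes "GDERIV g x :> a"
  shows "grad g x = a"
proof -
  have "frechet_derivative g (at x) = (\<lambda>h. h \<bullet> a)"
    using assms frechet_derivative_at unfolding gderiv_def by metis
  then show ?thesis
    by (simp add: grad_def partial_deriv_def vec_eq_iff inner_axis')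
qed

lemma GDERIV_grad:
  assumes "g differentiable at x"
  shows "GDERIV g x :> grad g x"
proof -
  let ?L = "frechet_derivative g (at x)"
  have D: "(g has_derivative ?L) (at x)"
    using assms frechet_derivative_works by blast
  then interpret L: bounded_linear ?L
    by (rule has_derivative_bounded_linear)
  have "?L h = h \<bullet> grad g x" for h
  proof -
    have "?L h = ?L (\<Sum>i\<in>UNIV. h $ i *\<^sub>R axis i 1)"
      using basis_expansion[of h] by (simp add: scalar_mult_eq_scaleR)
    also have "\<dots> = (\<Sum>i\<in>UNIV. h $ i * ?L (axis i 1))"
      by (simp add: L.sum L.scaleR)
    also have "\<dots> = h \<bullet> grad g x"
      by (simp add: inner_vec_def grad_def partial_deriv_def)
    finally show ?thesis .
  qed
  then have "?L = (\<lambda>h. h \<bullet> grad g x)" by auto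
  with D show ?thesis unfolding gderiv_def by simp
qed

text \<open>On an arbitrary set the class $C^1$ thus means: the gradient exists in the sense of
  \<^const>\<open>gderiv\<close> and is continuous. This form lets the calculus rules for \<^const>\<open>gderiv\<close> produce
  all derivatives below.\<close>
lemma C1_iff_grad:
  "Ck_on 1 S g \<longleftrightarrow> (\<forall>x\<in>S. GDERIV g x :> grad g x) \<and> continuous_on S (grad g)"
proof -
  have "(\<forall>x\<in>S. g differentiable at x) \<longleftrightarrow> (\<forall>x\<in>S. GDERIV g x :> grad g x)"
    using GDERIV_grad by (metis gderiv_def differentiable_def)
  moreover have "(\<forall>i. continuous_on S (partial_deriv i g)) \<longleftrightarrow> continuous_on S (grad g)"
  proof
    assume "\<forall>i. continuous_on S (partial_deriv i g)"
    then show "continuous_on S (grad g)"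
      unfolding grad_def by (intro continuous_on_vec_lambda) simp
  next
    assume *: "continuous_on S (grad g)"
    have "partial_deriv i g = (\<lambda>x. grad g x $ i)" for i
      by (simp add: grad_def)
    then show "\<forall>i. continuous_on S (partial_deriv i g)"
      using continuous_on_component[OF *] by simp
  qed
  ultimately show ?thesis
    by (simp add: One_nat_def)
qed

lemma C1_I:
  assumes "\<And>x. x \<in> S \<Longrightarrow> GDERIV g x :> G x" "continuous_on S G"
  shows "Ck_on 1 S g"
  unfolding C1_iff_grad
  using assms grad_eqI by (metis (no_types, lifting) continuous_on_cong)

lemma C1_D:
  assumes "Ck_on 1 S g"
  shows "x \<in> S \<Longrightarrow> GDERIV g x :> grad g x" "continuous_on S (grad g)"
  using assms unfolding C1_iff_grad by auto

lemma C1_continuous_on: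
  assumes "Ck_on 1 S g"
  shows "continuous_on S g"
  using assms unfolding C1_iff_grad gderiv_def
  by (metis continuous_at_imp_continuous_on has_derivative_continuous)

lemma GDERIV_zero_open:
  assumes "open U" "x \<in> U" "\<And>y. y \<in> U \<Longrightarrow> g y = 0"
  shows "GDERIV g x :> 0"
  unfolding gderiv_def
  by (rule has_derivative_transform_within_open[of "\<lambda>_. 0" _ _ _ U]) (use assms in auto)

section \<open>Test functions\<close>

text \<open>The gradient vanishes off the support because the complement of the support is open and the
  function is identically zero there. Integrals against a test function therefore see only a
  compact subset of the domain, whatever default values the other factor takes outside.\<close>
lemma test_function_outside:
  assumes "test_function U \<psi>" "x \<notin> closure {x. \<psi> x \<noteq> 0}"
  shows "\<psi> x = 0" "grad \<psi> x = 0"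
proof -
  let ?K = "closure {x. \<psi> x \<noteq> 0}"
  have 0: "\<psi> y = 0" if "y \<in> - ?K" for y
    using that subsetD[OF closure_subset, of y "{x. \<psi> x \<noteq> 0}"] by blast
  show "\<psi> x = 0"
    using 0[of x] assms(2) by blast
  have K: "open (- ?K)" "x \<in> - ?K"
    using assms(2) by (simp_all only: open_Compl closed_closure Compl_iff not_False_eq_True)
  show "grad \<psi> x = 0"
    by (rule grad_eqI[OF GDERIV_zero_open[OF K 0]])
qed

lemma test_function_C1:
  assumes "test_function U \<psi>"
  shows "GDERIV \<psi> x :> grad \<psi> x" "continuous_on S (grad \<psi>)" "continuous_on S \<psi>"
  using assms C1_continuous_on[of UNIV \<psi>] unfolding test_function_def C1_iff_grad
  by (auto intro: continuous_on_subset)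

lemma integrable_continuous_compact_support:
  fixes F :: "real ^ 'n \<Rightarrow> real"
  assumes "compact K" "continuous_on K F" "\<And>x. x \<notin> K \<Longrightarrow> F x = 0"
  shows "integrable lborel F" "integrable lebesgue F"
proof -
  have "(\<lambda>x. indicator K x *\<^sub>R F x) = F"
    using assms(3) by (auto simp: indicator_def fun_eq_iff)
  then show *: "integrable lborel F"
    using borel_integrable_compact[OF assms(1,2)] by simp
  show "integrable lebesgue F"
    using * integrable_completion[OF borel_measurable_integrable[OF *]] by simp
qed

lemma integrable_grad_test:
  assumes "Ck_on 1 U v" "test_function U \<psi>"
  shows "integrable lebesgue (\<lambda>x. grad v x \<bullet> grad \<psi> x)"
proof (rule integrable_continuous_compact_support)
  show "compact (closure {x. \<psi> x \<noteq> 0})"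
    using assms(2) unfolding test_function_def by simp
  have "continuous_on (closure {x. \<psi> x \<noteq> 0}) (grad v)"
    using assms unfolding test_function_def C1_iff_grad by (auto intro: continuous_on_subset)
  then show "continuous_on (closure {x. \<psi> x \<noteq> 0}) (\<lambda>x. grad v x \<bullet> grad \<psi> x)"
    by (intro continuous_on_inner test_function_C1(2)[OF assms(2)])
  show "grad v x \<bullet> grad \<psi> x = 0" if "x \<notin> closure {x. \<psi> x \<noteq> 0}" for x
    using test_function_outside(2)[OF assms(2) that] by simp
qed

definition locally_integrable_on :: "(real ^ 'n) set \<Rightarrow> (real ^ 'n \<Rightarrow> real) \<Rightarrow> bool" where
  "locally_integrable_on U g \<longleftrightarrow> (\<forall>K. compact K \<and> K \<subseteq> U \<longrightarrow> set_integrable lebesgue K g)"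

lemma test_function_bounded:
  assumes "test_function U \<psi>"
  obtains B where "\<And>x. \<bar>\<psi> x\<bar> \<le> B" "B \<ge> 0"
proof -
  let ?K = "closure {x. \<psi> x \<noteq> 0}"
  have "compact ?K"
    using assms unfolding test_function_def by blast
  then have "bounded (\<psi> ` ?K)"
    using test_function_C1(3)[OF assms] by (intro compact_imp_bounded compact_continuous_image)
  then obtain B where "B > 0" "\<forall>x\<in>?K. \<bar>\<psi> x\<bar> \<le> B"
    by (auto simp: bounded_pos)
  then have "\<bar>\<psi> x\<bar> \<le> B" for x
    using test_function_outside(1)[OF assms, of x] by (cases "x \<in> ?K") auto
  then show thesis using \<open>B > 0\<close> by (intro that[of B]) auto
qed

lemma integrable_times_test:
  assumes "locally_integrable_on U g" "test_function U \<psi>"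
  shows "integrable lebesgue (\<lambda>x. g x * \<psi> x)"
proof -
  let ?K = "closure {x. \<psi> x \<noteq> 0}"
  obtain B where B: "\<And>x. \<bar>\<psi> x\<bar> \<le> B" "B \<ge> 0"
    using test_function_bounded[OF assms(2)] by blast
  have g: "integrable lebesgue (\<lambda>x. indicator ?K x * g x)"
    using assms unfolding locally_integrable_on_def test_function_def set_integrable_def by auto
  have "\<psi> \<in> borel_measurable borel"
    using test_function_C1(3)[OF assms(2)] borel_measurable_continuous_onI by blast
  then have [measurable]: "\<psi> \<in> borel_measurable lebesgue"
    by (simp add: borel_measurable_if_lebesgue_on measurable_completion)
  have eq: "(\<lambda>x. g x * \<psi> x) = (\<lambda>x. (indicator ?K x * g x) * \<psi> x)"
  proof
    fix x show "g x * \<psi> x = (indicator ?K x * g x) * \<psi> x"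
      using test_function_outside(1)[OF assms(2), of x] by (cases "x \<in> ?K") simp_all
  qed
  show ?thesis unfolding eq
  proof (rule Bochner_Integration.integrable_bound)
    show "integrable lebesgue (\<lambda>x. B * (indicator ?K x * g x))"
      using g by simp
    show "(\<lambda>x. indicator ?K x * g x * \<psi> x) \<in> borel_measurable lebesgue"
      using borel_measurable_integrable[OF g] by measurable
    show "AE x in lebesgue. norm (indicator ?K x * g x * \<psi> x) \<le> norm (B * (indicator ?K x * g x))"
      using B by (auto simp: abs_mult mult.commute intro!: mult_right_mono)
  qed
qed

section \<open>Weak solutions of the Poisson equation\<close>

text \<open>Integrating over the whole space makes the equation local: the same identity is inherited by
  every subset of \<open>U\<close>, and linear changes of variables need not track the domain of integration.
  Boundary values are kept out of the definition, so that it can be restricted to small cubes.\<close>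
definition weak_solution ::
    "(real ^ 'n) set \<Rightarrow> (real ^ 'n \<Rightarrow> real) \<Rightarrow> (real ^ 'n \<Rightarrow> real) \<Rightarrow> bool" where
  "weak_solution U g v \<longleftrightarrow>
     Ck_on 1 U v \<and> locally_integrable_on U g \<and>
     (\<forall>\<psi>. test_function U \<psi> \<longrightarrow>
        (LINT x|lebesgue. grad v x \<bullet> grad \<psi> x) = (LINT x|lebesgue. g x * \<psi> x))"

text \<open>Dropping the indicator of the domain is harmless, since a test function and its gradient
  vanish outside the domain.\<close>
lemma dirichlet_imp_weak_solution:
  assumes "dirichlet_solution \<Omega> g v"
  shows "weak_solution \<Omega> g v"
proof -
  have "(LINT x|lebesgue. grad v x \<bullet> grad \<psi> x) = (LINT x|lebesgue. g x * \<psi> x)"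
    if \<psi>: "test_function \<Omega> \<psi>" for \<psi>
  proof -
    have 0: "\<psi> x = 0 \<and> grad \<psi> x = 0" if "x \<notin> \<Omega>" for x
      using test_function_outside[OF \<psi>, of x] \<psi> that unfolding test_function_def by blast
    then have "(\<lambda>x. indicator \<Omega> x *\<^sub>R (grad v x \<bullet> grad \<psi> x)) = (\<lambda>x. grad v x \<bullet> grad \<psi> x)"
      "(\<lambda>x. indicator \<Omega> x *\<^sub>R (g x * \<psi> x)) = (\<lambda>x. g x * \<psi> x)"
      by (auto simp: fun_eq_iff indicator_def)
    moreover have "(LINT x:\<Omega>|lebesgue. grad v x \<bullet> grad \<psi> x) = (LINT x:\<Omega>|lebesgue. g x * \<psi> x)"
      using assms \<psi> unfolding dirichlet_solution_def by blast
    ultimately show ?thesis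
      unfolding set_lebesgue_integral_def by simp
  qed
  then show ?thesis
    using assms unfolding dirichlet_solution_def weak_solution_def locally_integrable_on_def by blast
qed

lemma test_function_mono:
  "test_function V \<psi> \<Longrightarrow> V \<subseteq> U \<Longrightarrow> test_function U \<psi>"
  unfolding test_function_def by blast

lemma weak_solution_subset:
  assumes "weak_solution U g v" "V \<subseteq> U"
  shows "weak_solution V g v"
  using assms test_function_mono[of V _ U]
  unfolding weak_solution_def locally_integrable_on_def C1_iff_grad
  by (auto intro: continuous_on_subset)

lemma weak_solution_lincomb:
  assumes "weak_solution U g v" "weak_solution U h w"
  shows "weak_solution U (\<lambda>x. a * g x + b * h x) (\<lambda>x. a * v x + b * w x)"
proof -
  have G: "GDERIV (\<lambda>x. a * v x + b * w x) x :> a *\<^sub>R grad v x + b *\<^sub>R grad w x" if "x \<in> U" for x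
  proof -
    have "GDERIV v x :> grad v x" "GDERIV w x :> grad w x"
      using assms that unfolding weak_solution_def C1_iff_grad by auto
    then show ?thesis
      using GDERIV_add[OF GDERIV_mult[OF GDERIV_const] GDERIV_mult[OF GDERIV_const]]
      by fastforce
  qed
  have C: "Ck_on 1 U (\<lambda>x. a * v x + b * w x)"
    by (rule C1_I, erule G)
       (use assms C1_D(2) in \<open>unfold weak_solution_def, intro continuous_intros, blast+\<close>)
  have L: "locally_integrable_on U (\<lambda>x. a * g x + b * h x)"
    using assms unfolding weak_solution_def locally_integrable_on_def
    by (auto intro!: set_integral_add set_integrable_mult_right)
  have "(LINT x|lebesgue. grad (\<lambda>x. a * v x + b * w x) x \<bullet> grad \<psi> x)
      = (LINT x|lebesgue. (a * g x + b * h x) * \<psi> x)" if \<psi>: "test_function U \<psi>" for \<psi>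
  proof -
    note I = integrable_grad_test[OF _ \<psi>] integrable_times_test[OF _ \<psi>]
    have W: "Ck_on 1 U v" "Ck_on 1 U w" "locally_integrable_on U g" "locally_integrable_on U h"
      "(LINT x|lebesgue. grad v x \<bullet> grad \<psi> x) = (LINT x|lebesgue. g x * \<psi> x)"
      "(LINT x|lebesgue. grad w x \<bullet> grad \<psi> x) = (LINT x|lebesgue. h x * \<psi> x)"
      using assms \<psi> unfolding weak_solution_def by auto
    have "grad (\<lambda>x. a * v x + b * w x) x \<bullet> grad \<psi> x
        = a * (grad v x \<bullet> grad \<psi> x) + b * (grad w x \<bullet> grad \<psi> x)" for x
    proof (cases "x \<in> U")
      case True
      then show ?thesis using grad_eqI[OF G[OF True]] by (simp add: inner_add_left)
    next
      case False
      then have "grad \<psi> x = 0"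
        using test_function_outside(2)[OF \<psi>] \<psi> unfolding test_function_def by blast
      then show ?thesis by simp
    qed
    then have "(LINT x|lebesgue. grad (\<lambda>x. a * v x + b * w x) x \<bullet> grad \<psi> x)
      = a * (LINT x|lebesgue. g x * \<psi> x) + b * (LINT x|lebesgue. h x * \<psi> x)"
      using W I by simp
    also have "\<dots> = (LINT x|lebesgue. a * (g x * \<psi> x) + b * (h x * \<psi> x))"
      using W I by simp
    finally show ?thesis by (simp add: algebra_simps)
  qed
  with C L show ?thesis unfolding weak_solution_def by blast
qed

section \<open>The weak maximum principle\<close>

text \<open>Unlike the positive part itself, its square is $C^1$. The remainder of the first-order expansion
  is at most the square of the increment, in each of the four sign cases.\<close>
lemma DERIV_positive_part_square:
  "((\<lambda>t. (max 0 t)\<^sup>2) has_real_derivative 2 * max 0 t) (at t)"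
  unfolding has_field_derivative_def
proof (rule has_derivativeI_sandwich[where e = 1 and H = "\<lambda>y. \<bar>y - t\<bar>"])
  fix y :: real assume "y \<noteq> t"
  have "\<bar>(max 0 y)\<^sup>2 - (max 0 t)\<^sup>2 - 2 * max 0 t * (y - t)\<bar> \<le> (y - t)\<^sup>2"
  proof (cases "t \<ge> 0"; cases "y \<ge> 0")
    assume t: "t \<ge> 0" and y: "\<not> y \<ge> 0"
    then have "t * y \<le> 0" by (simp add: mult_nonneg_nonpos)
    then have "\<bar>t\<^sup>2 - 2 * (t * y)\<bar> \<le> y\<^sup>2 + t\<^sup>2 - 2 * (t * y)"
      using zero_le_power2[of t] zero_le_power2[of y] by linarith
    moreover have "0\<^sup>2 - t\<^sup>2 - 2 * t * (y - t) = t\<^sup>2 - 2 * (t * y)"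
      "(y - t)\<^sup>2 = y\<^sup>2 + t\<^sup>2 - 2 * (t * y)"
      by (simp_all add: power2_eq_square algebra_simps)
    moreover have "max 0 y = 0" "max 0 t = t" using t y by auto
    ultimately show ?thesis by (simp only:)
  next
    assume t: "\<not> t \<ge> 0" and y: "y \<ge> 0"
    then have "t * y \<le> 0" by (simp add: mult_nonpos_nonneg)
    moreover have "(y - t)\<^sup>2 = y\<^sup>2 + t\<^sup>2 - 2 * (t * y)"
      by (simp add: power2_eq_square algebra_simps)
    ultimately have "y\<^sup>2 \<le> (y - t)\<^sup>2"
      using zero_le_power2[of t] by linarith
    then show ?thesis using t y by (simp add: max_def)
  next
    assume t: "t \<ge> 0" and y: "y \<ge> 0"
    have "y\<^sup>2 - t\<^sup>2 - 2 * t * (y - t) = (y - t)\<^sup>2"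
      by (simp add: power2_eq_square algebra_simps)
    moreover have "max 0 y = y" "max 0 t = t" using t y by auto
    ultimately show ?thesis by (simp only:) simp
  qed simp
  then show "norm ((max 0 y)\<^sup>2 - (max 0 t)\<^sup>2 - 2 * max 0 t * (y - t)) / norm (y - t) \<le> \<bar>y - t\<bar>"
    using \<open>y \<noteq> t\<close> by (simp add: divide_le_eq power2_eq_square abs_mult[symmetric])
next
  show "((\<lambda>y. \<bar>y - t\<bar>) \<longlongrightarrow> 0) (at t)"
    by (rule tendsto_eq_intros refl | simp)+
qed (auto intro: bounded_linear_mult_right)

lemma zero_if_integral_zero:
  fixes F :: "real ^ 'n \<Rightarrow> real"
  assumes "continuous_on UNIV F" "integrable lebesgue F" "\<And>x. F x \<ge> 0"
    "(LINT x|lebesgue. F x) = 0"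
  shows "F x = 0"
proof -
  have "AE x in lebesgue. F x = 0"
    using integral_nonneg_eq_0_iff_AE[OF assms(2)] assms by simp
  then obtain N where "N \<in> null_sets lebesgue" "{x. F x \<noteq> 0} \<subseteq> N"
    by (auto simp: eventually_ae_filter)
  then have "negligible {x. F x \<noteq> 0}"
    using negligible_iff_null_sets negligible_subset by blast
  moreover have "open {x. F x \<noteq> 0}"
    using open_Collect_neq[OF assms(1) continuous_on_const] .
  ultimately show ?thesis
    using open_not_negligible by blast
qed

text \<open>Suppose $z$ exceeds $\<eta> > 0$ somewhere. Then $((z - \<eta>)^+)^2$ is an admissible test function: it is
  $C^1$, and its support lies in the compact set $\{z \<ge> \<eta>\}$, which stays away from the boundary.
  Testing gives $\<integral> 2 (z - \<eta>)^+ |\<nabla> z|^2 \<le> 0$. The integrand is continuous and nonnegative, so it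
  vanishes, hence so does the gradient of the test function. A constant with compact support is zero,
  a contradiction. The sign of the right-hand side matters only where $z > 0$; this is what allows
  comparison with a right-hand side that is controlled only where the solution is large.\<close>
lemma weak_maximum_principle:
  fixes z :: "real ^ 'n \<Rightarrow> real"
  assumes U: "open U" "bounded U"
    and z: "weak_solution U g z"
    and sub: "\<And>x. x \<in> U \<Longrightarrow> z x > 0 \<Longrightarrow> g x \<le> 0"
    and cont: "continuous_on (closure U) z"
    and bd: "\<And>x. x \<in> frontier U \<Longrightarrow> z x \<le> 0"
    and x0: "x0 \<in> U"
  shows "z x0 \<le> 0"
proof (rule ccontr)
  assume pos: "\<not> z x0 \<le> 0"
  define \<eta> where "\<eta> = z x0 / 2"
  have \<eta>: "\<eta> > 0" "z x0 > \<eta>" using pos unfolding \<eta>_def by auto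
  define K where "K = {x \<in> closure U. \<eta> \<le> z x}"
  have K: "compact K"
    unfolding K_def compact_eq_bounded_closed
    using U cont by (auto intro: bounded_subset[OF bounded_closure] continuous_closed_preimage_constant
      simp: continuous_on_closed_Collect_le)
  have KU: "K \<subseteq> U"
    using bd \<eta>(1) U unfolding K_def frontier_def by (force simp: interior_open)
  define m where "m x = max 0 (z x - \<eta>)" for x
  define \<psi> where "\<psi> x = (if x \<in> U then (m x)\<^sup>2 else 0)" for x
  define G where "G x = (if x \<in> U then (2 * m x) *\<^sub>R grad z x else 0)" for x
  have zC: "Ck_on 1 U z" using z unfolding weak_solution_def by simp
  have outside: "m x = 0" if "x \<in> U" "x \<notin> K" for x
    using that closure_subset unfolding m_def K_def by fastforce
  have \<psi>0: "\<psi> x = 0" and G0: "G x = 0" if "x \<in> - K" for x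
    using that outside[of x] unfolding \<psi>_def G_def by auto
  have cover: "U \<union> - K = UNIV" using KU by blast
  have D: "GDERIV \<psi> x :> G x" for x
  proof (cases "x \<in> U")
    case True
    have "GDERIV (\<lambda>y. z y - \<eta>) x :> grad z x - 0"
      using zC True unfolding C1_iff_grad by (intro GDERIV_diff GDERIV_const) auto
    from GDERIV_DERIV_compose[OF this DERIV_positive_part_square]
    have "GDERIV (\<lambda>y. (m y)\<^sup>2) x :> G x"
      using True unfolding m_def G_def by simp
    then show ?thesis
      unfolding gderiv_def
      by (rule has_derivative_transform_within_open[OF _ U(1) True]) (simp add: \<psi>_def)
  next
    case False
    then have x: "x \<in> - K" using KU by blast
    have "GDERIV \<psi> x :> 0"
      by (rule GDERIV_zero_open[OF _ x]) (use K \<psi>0 compact_imp_closed in \<open>auto simp: open_Compl\<close>)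
    then show ?thesis using G0[OF x] by simp
  qed
  have Gc: "continuous_on UNIV G"
  proof -
    have "continuous_on U (\<lambda>x. (2 * m x) *\<^sub>R grad z x)"
      using zC C1_continuous_on[OF zC] unfolding C1_iff_grad m_def by (intro continuous_intros) auto
    then have "continuous_on U G"
      by (rule continuous_on_eq) (simp add: G_def)
    moreover have "continuous_on (- K) G"
      by (rule continuous_on_eq[OF continuous_on_const[of _ 0]]) (simp add: G0)
    ultimately show ?thesis
      using continuous_on_open_Un[OF U(1), of "- K" G] K cover
      by (simp add: open_Compl compact_imp_closed)
  qed
  have supp: "closure {x. \<psi> x \<noteq> 0} \<subseteq> K"
    by (rule closure_minimal) (use \<psi>0 K compact_imp_closed in auto)
  have \<psi>: "test_function U \<psi>"
    unfolding test_function_def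
  proof (intro conjI)
    show "Ck_on 1 UNIV \<psi>" by (rule C1_I[OF D Gc])
    show "compact (closure {x. \<psi> x \<noteq> 0})"
      using supp K by (meson closed_closure compact_Int_closed compact_eq_bounded_closed bounded_subset)
    show "closure {x. \<psi> x \<noteq> 0} \<subseteq> U" using supp KU by blast
  qed
  have eq: "grad z x \<bullet> grad \<psi> x = (if x \<in> U then 2 * m x * (grad z x \<bullet> grad z x) else 0)" for x
    using grad_eqI[OF D] by (simp add: G_def)
  have nonneg: "grad z x \<bullet> grad \<psi> x \<ge> 0" for x
    unfolding eq by (simp add: m_def)
  have I: "integrable lebesgue (\<lambda>x. grad z x \<bullet> grad \<psi> x)"
    by (rule integrable_grad_test[OF zC \<psi>])
  have "(LINT x|lebesgue. grad z x \<bullet> grad \<psi> x) = (LINT x|lebesgue. g x * \<psi> x)"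
    using z \<psi> unfolding weak_solution_def by blast
  also have "\<dots> \<le> 0"
  proof -
    have "g x * \<psi> x \<le> 0" for x
    proof (cases "\<psi> x = 0")
      case False
      then have "x \<in> U" "z x > 0"
        using \<eta> unfolding \<psi>_def m_def by (auto split: if_splits simp: max_def)
      then have "g x \<le> 0" using sub by blast
      then show ?thesis by (simp add: \<psi>_def mult_nonpos_nonneg)
    qed simp
    then have "0 \<le> (LINT x|lebesgue. - (g x * \<psi> x))"
      by (intro Bochner_Integration.integral_nonneg) simp
    then show ?thesis by simp
  qed
  finally have int0: "(LINT x|lebesgue. grad z x \<bullet> grad \<psi> x) = 0"
    using Bochner_Integration.integral_nonneg[of lebesgue "\<lambda>x. grad z x \<bullet> grad \<psi> x"] nonneg by (simp add: order_antisym)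
  have "continuous_on UNIV (\<lambda>x. grad z x \<bullet> grad \<psi> x)"
  proof -
    have "continuous_on U (\<lambda>x. grad z x \<bullet> grad \<psi> x)"
      using zC test_function_C1(2)[OF \<psi>] unfolding C1_iff_grad by (intro continuous_intros) auto
    moreover have "continuous_on (- K) (\<lambda>x. grad z x \<bullet> grad \<psi> x)"
      by (rule continuous_on_eq[OF continuous_on_const[of _ 0]]) (simp add: G0 grad_eqI[OF D])
    ultimately show ?thesis
      using continuous_on_open_Un[OF U(1), of "- K"] K cover
      by (simp add: open_Compl compact_imp_closed)
  qed
  from zero_if_integral_zero[OF this I nonneg int0]
  have gz: "grad z x \<bullet> grad \<psi> x = 0" for x .
  have "G x = 0" for x
    using eq[of x] unfolding gz G_def by (auto split: if_splits)
  then have "\<exists>c. \<forall>x\<in>UNIV. \<psi> x = c"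
    using D by (intro has_derivative_zero_constant) (simp_all add: gderiv_def)
  then obtain c where c: "\<And>x. \<psi> x = c" by auto
  obtain y where "y \<notin> K"
    using compact_imp_bounded[OF K] not_bounded_UNIV[where 'a = "real ^ 'n"]
    by (metis UNIV_eq_I)
  then have "c = 0" using c[of y] \<psi>0[of y] by simp
  moreover have "\<psi> x0 > 0" using x0 \<eta> unfolding \<psi>_def m_def by (simp add: max_def)
  ultimately show False using c[of x0] by simp
qed

lemma weak_comparison:
  fixes v\<^sub>1 v\<^sub>2 :: "real ^ 'n \<Rightarrow> real"
  assumes U: "open U" "bounded U"
    and v: "weak_solution U g\<^sub>1 v\<^sub>1" "weak_solution U g\<^sub>2 v\<^sub>2"
    and g: "\<And>x. x \<in> U \<Longrightarrow> v\<^sub>2 x < v\<^sub>1 x \<Longrightarrow> g\<^sub>1 x \<le> g\<^sub>2 x"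
    and cont: "continuous_on (closure U) v\<^sub>1" "continuous_on (closure U) v\<^sub>2"
    and bd: "\<And>x. x \<in> frontier U \<Longrightarrow> v\<^sub>1 x \<le> v\<^sub>2 x"
    and x: "x \<in> U"
  shows "v\<^sub>1 x \<le> v\<^sub>2 x"
proof -
  have "1 * v\<^sub>1 x + (- 1) * v\<^sub>2 x \<le> 0"
    by (rule weak_maximum_principle[OF U weak_solution_lincomb[OF v, of 1 "- 1"] _ _ _ x])
       (use g bd cont in \<open>auto intro!: continuous_intros\<close>)
  then show ?thesis by simp
qed

section \<open>Quadratic polynomials as weak solutions\<close>

lemma GDERIV_imp_directional:
  assumes "GDERIV v p :> a"
  shows "((\<lambda>t. v (p + t *\<^sub>R e)) has_real_derivative e \<bullet> a) (at 0)"
proof -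
  have l: "((\<lambda>t::real. p + t *\<^sub>R e) has_derivative (\<lambda>t. t *\<^sub>R e)) (at 0)"
    by (auto intro!: derivative_eq_intros)
  have "(v has_derivative (\<lambda>h. h \<bullet> a)) (at (p + 0 *\<^sub>R e))"
    using assms unfolding gderiv_def by simp
  from has_derivative_compose[OF l this]
  show ?thesis
    unfolding has_field_derivative_def by (simp add: mult.commute[of "e \<bullet> a"] mult_commute_abs)
qed

text \<open>By translation invariance the difference quotients of \<open>\<psi>\<close> in a coordinate direction have integral
  zero. They are bounded by the Lipschitz constant and supported in a fixed ball, so dominated
  convergence carries this over to the partial derivative.\<close>
lemma integral_grad_component_zero:
  fixes \<psi> :: "real ^ 'n \<Rightarrow> real"
  assumes \<psi>: "test_function U \<psi>"
  shows "integrable lebesgue (\<lambda>x. grad \<psi> x $ i)" "(LINT x|lebesgue. grad \<psi> x $ i) = 0"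
proof -
  let ?K = "closure {x. \<psi> x \<noteq> 0}"
  define e :: "real ^ 'n" where "e = axis i 1"
  have e: "norm e = 1" unfolding e_def by simp
  have comp: "grad \<psi> x $ i = e \<bullet> grad \<psi> x" for x
    unfolding e_def by (simp add: inner_axis')
  have K: "compact ?K" using \<psi> unfolding test_function_def by simp
  note out = test_function_outside[OF \<psi>]
  note C = test_function_C1[OF \<psi>]
  have cont: "continuous_on S (\<lambda>x. grad \<psi> x $ i)" for S
    by (rule continuous_on_component[OF C(2)])
  have int: "integrable lborel (\<lambda>x. grad \<psi> x $ i)" "integrable lebesgue (\<lambda>x. grad \<psi> x $ i)"
    by (rule integrable_continuous_compact_support[OF K cont]; simp add: out(2) del: mem_Collect_eq)+
  then show "integrable lebesgue (\<lambda>x. grad \<psi> x $ i)" by simp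
  have intp: "integrable lborel \<psi>"
    by (rule integrable_continuous_compact_support[OF K C(3)]) (rule out(1))
  obtain r where r: "\<And>x. x \<in> ?K \<Longrightarrow> norm x \<le> r"
    using compact_imp_bounded[OF K] unfolding bounded_iff by blast
  have "bounded (grad \<psi> ` ?K)"
    using compact_imp_bounded[OF compact_continuous_image[OF C(2) K]] .
  then obtain B where B0: "B > 0" "\<forall>x\<in>?K. norm (grad \<psi> x) \<le> B"
    by (auto simp: bounded_pos)
  then have B: "norm (grad \<psi> x) \<le> B" for x
  proof (cases "x \<in> ?K")
    case True
    then show ?thesis using B0(2) by blast
  next
    case False
    show ?thesis using out(2)[OF False] B0(1) by simp
  qed
  have lip: "\<bar>\<psi> y - \<psi> x\<bar> \<le> B * norm (y - x)" for x y
    unfolding real_norm_def[symmetric]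
  proof (rule differentiable_bound[of UNIV \<psi> "\<lambda>x h. h \<bullet> grad \<psi> x"])
    show "onorm (\<lambda>h. h \<bullet> grad \<psi> x) \<le> B" for x
    proof (rule onorm_le)
      fix h show "norm (h \<bullet> grad \<psi> x) \<le> B * norm h"
        using Cauchy_Schwarz_ineq2[of h "grad \<psi> x"] mult_left_mono[OF B[of x], of "norm h"]
        by (simp add: mult.commute)
    qed
  qed (use C(1) in \<open>auto simp: gderiv_def\<close>)
  define t where "t n = inverse (real (Suc n))" for n
  have t: "t n > 0" "t n \<le> 1" for n unfolding t_def by (auto simp: inverse_le_1_iff)
  define s where "s n x = (\<psi> (t n *\<^sub>R e + x) - \<psi> x) / t n" for n x
  have shift: "integrable lborel (\<lambda>x. \<psi> (c + x))"
    "(LINT x|lborel. \<psi> (c + x)) = (LINT x|lborel. \<psi> x)" for c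
  proof -
    have d: "distr lborel borel ((+) c) = lborel" by (rule lborel_distr_plus)
    have m: "(+) c \<in> lborel \<rightarrow>\<^sub>M borel" by measurable
    have mp: "\<psi> \<in> borel_measurable borel" using borel_measurable_integrable[OF intp] by simp
    show "integrable lborel (\<lambda>x. \<psi> (c + x))"
      using integrable_distr_eq[OF m mp] intp unfolding d by simp
    show "(LINT x|lborel. \<psi> (c + x)) = (LINT x|lborel. \<psi> x)"
      using integral_distr[OF m mp] unfolding d by simp
  qed
  have s0: "(LINT x|lborel. s n x) = 0" for n
    unfolding s_def using shift intp by simp
  have sint: "integrable lborel (s n)" for n
    unfolding s_def using shift intp by simp
  have "(\<lambda>n. LINT x|lborel. s n x) \<longlonglongrightarrow> (LINT x|lborel. grad \<psi> x $ i)"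
  proof (rule integral_dominated_convergence[where w = "\<lambda>x. indicator (cball 0 (r + 1)) x *\<^sub>R B"])
    show "integrable lborel (\<lambda>x. indicator (cball (0::real^'n) (r + 1)) x *\<^sub>R B)"
      by (rule borel_integrable_compact) auto
    show "AE x in lborel. (\<lambda>n. s n x) \<longlonglongrightarrow> grad \<psi> x $ i"
    proof (rule AE_I2)
      fix x
      have "((\<lambda>h. (\<psi> (x + h *\<^sub>R e) - \<psi> x) / h) \<longlongrightarrow> grad \<psi> x $ i) (at 0)"
        using GDERIV_imp_directional[OF C(1), of x e] unfolding DERIV_def comp by simp
      moreover have "filterlim t (at 0) sequentially"
        unfolding t_def by (rule filterlim_atI[OF LIMSEQ_inverse_real_of_nat]) simp
      ultimately show "(\<lambda>n. s n x) \<longlonglongrightarrow> grad \<psi> x $ i"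
        unfolding s_def add.commute[of _ x] by (rule filterlim_compose)
    qed
    fix n
    show "AE x in lborel. norm (s n x) \<le> indicator (cball 0 (r + 1)) x *\<^sub>R B"
    proof (rule AE_I2)
      fix x
      show "norm (s n x) \<le> indicator (cball 0 (r + 1)) x *\<^sub>R B"
      proof (cases "x \<in> cball 0 (r + 1)")
        case True
        have "\<bar>\<psi> (t n *\<^sub>R e + x) - \<psi> x\<bar> \<le> B * t n"
          using lip[of "t n *\<^sub>R e + x" x] t[of n] e by simp
        then show ?thesis using True t[of n] by (simp add: s_def divide_le_eq)
      next
        case False
        then have "norm x > r + 1" by simp
        moreover have "norm x \<le> norm (t n *\<^sub>R e + x) + t n"
          using norm_triangle_ineq4[of "t n *\<^sub>R e + x" "t n *\<^sub>R e"] e t[of n] by simp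
        ultimately have "x \<notin> ?K" "t n *\<^sub>R e + x \<notin> ?K"
          using r[of x] r[of "t n *\<^sub>R e + x"] t[of n] by force+
        from this[THEN out(1)] show ?thesis using False by (simp add: s_def)
      qed
    qed
  qed (use int sint in auto)
  then have "(LINT x|lborel. grad \<psi> x $ i) = 0"
    unfolding s0 using LIMSEQ_unique tendsto_const by blast
  then show "(LINT x|lebesgue. grad \<psi> x $ i) = 0"
    using integral_completion[of "\<lambda>x. grad \<psi> x $ i" lborel] int(1) by simp
qed

lemma GDERIV_vec_nth: "GDERIV (\<lambda>x. x $ i) x :> axis i 1"
  unfolding gderiv_def inner_axis
  by (auto intro!: bounded_linear_imp_has_derivative bounded_linear_vec_nth)

lemma GDERIV_sum:
  assumes "\<And>i. i \<in> I \<Longrightarrow> GDERIV (f i) x :> D i"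
  shows "GDERIV (\<lambda>x. \<Sum>i\<in>I. f i x) x :> (\<Sum>i\<in>I. D i)"
  using assms unfolding gderiv_def inner_sum_right by (intro has_derivative_sum)

text \<open>The barriers for the comparison arguments are of this form. The Laplacian is the constant
  \<open>\<Sum>i. 2 * a i\<close>.\<close>
definition diag_quadratic ::
    "real ^ 'n \<Rightarrow> real \<Rightarrow> ('n \<Rightarrow> real) \<Rightarrow> ('n \<Rightarrow> real) \<Rightarrow> real ^ 'n \<Rightarrow> real" where
  "diag_quadratic p c a b x = c + (\<Sum>i\<in>UNIV. a i * (x $ i - p $ i)\<^sup>2 + b i * (x $ i - p $ i))"

lemma GDERIV_diag_quadratic:
  "GDERIV (diag_quadratic p c a b) x :> (\<chi> i. 2 * a i * (x $ i - p $ i) + b i)"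
proof -
  have "GDERIV (\<lambda>x. a i * (x $ i - p $ i)\<^sup>2 + b i * (x $ i - p $ i)) x
      :> (2 * a i * (x $ i - p $ i) + b i) *\<^sub>R axis i 1" for i
  proof (rule GDERIV_DERIV_compose[where g = "\<lambda>s. a i * (s - p $ i)\<^sup>2 + b i * (s - p $ i)",
        OF GDERIV_vec_nth])
    show "((\<lambda>s. a i * (s - p $ i)\<^sup>2 + b i * (s - p $ i))
        has_real_derivative 2 * a i * (x $ i - p $ i) + b i) (at (x $ i))"
      by (auto intro!: derivative_eq_intros)
  qed
  from GDERIV_add[OF GDERIV_const GDERIV_sum[OF this]]
  have "GDERIV (diag_quadratic p c a b) x
      :> 0 + (\<Sum>i\<in>UNIV. (2 * a i * (x $ i - p $ i) + b i) *\<^sub>R axis i 1)"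
    unfolding diag_quadratic_def .
  moreover have "(\<Sum>i\<in>UNIV. (2 * a i * (x $ i - p $ i) + b i) *\<^sub>R axis i 1)
      = (\<chi> i. 2 * a i * (x $ i - p $ i) + b i)"
    by (simp add: vec_eq_iff axis_def if_distrib cong: if_cong)
  ultimately show ?thesis by simp
qed

text \<open>Integration by parts, one coordinate at a time: the \<open>i\<close>-th partial derivative \<open>Q i\<close> is affine in the
  \<open>i\<close>-th coordinate alone, and the \<open>i\<close>-th partial derivative of \<open>Q i * \<psi>\<close> integrates to zero.\<close>
lemma weak_solution_diag_quadratic:
  fixes p :: "real ^ 'n"
  shows "weak_solution U (\<lambda>x. - (\<Sum>i\<in>UNIV. 2 * a i)) (diag_quadratic p c a b)"
proof -
  define Q where "Q i x = 2 * a i * (x $ i - p $ i) + b i" for i and x :: "real ^ 'n"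
  have g: "grad (diag_quadratic p c a b) x = (\<chi> i. Q i x)" for x
    unfolding Q_def by (rule grad_eqI[OF GDERIV_diag_quadratic])
  have Qc: "continuous_on S (Q i)" for S i
    unfolding Q_def by (intro continuous_intros)
  have C: "Ck_on 1 U (diag_quadratic p c a b)"
    by (rule C1_I[OF GDERIV_diag_quadratic]) (intro continuous_intros)
  have "(LINT x|lebesgue. grad (diag_quadratic p c a b) x \<bullet> grad \<psi> x)
      = (LINT x|lebesgue. - (\<Sum>i\<in>UNIV. 2 * a i) * \<psi> x)" if \<psi>: "test_function U \<psi>" for \<psi>
  proof -
    have i1: "integrable lebesgue (\<lambda>x. grad (diag_quadratic p c a b) x \<bullet> grad \<psi> x)"
      by (rule integrable_grad_test[OF C \<psi>])
    have i2: "integrable lebesgue \<psi>"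
      using integrable_continuous_compact_support(2)[OF _ test_function_C1(3)[OF \<psi>]]
        test_function_outside(1)[OF \<psi>] \<psi> unfolding test_function_def by blast
    have D: "GDERIV (\<lambda>x. Q i x * \<psi> x) x :> Q i x *\<^sub>R grad \<psi> x + \<psi> x *\<^sub>R ((2 * a i) *\<^sub>R axis i 1)"
      for i x
    proof (rule GDERIV_mult[OF _ test_function_C1(1)[OF \<psi>]])
      have "((\<lambda>s. 2 * a i * (s - p $ i) + b i) has_real_derivative 2 * a i) (at (x $ i))"
        by (auto intro!: derivative_eq_intros)
      from GDERIV_DERIV_compose[OF GDERIV_vec_nth this]
      show "GDERIV (Q i) x :> (2 * a i) *\<^sub>R axis i 1"
        unfolding Q_def .
    qed
    have T: "test_function U (\<lambda>x. Q i x * \<psi> x)" for i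
    proof -
      have sub: "closure {x. Q i x * \<psi> x \<noteq> 0} \<subseteq> closure {x. \<psi> x \<noteq> 0}"
        by (rule closure_mono) auto
      have "Ck_on 1 UNIV (\<lambda>x. Q i x * \<psi> x)"
        by (rule C1_I[OF D]) (intro continuous_intros Qc test_function_C1[OF \<psi>])
      moreover have "compact (closure {x. Q i x * \<psi> x \<noteq> 0})"
        using sub \<psi> unfolding test_function_def
        by (meson closed_closure compact_eq_bounded_closed bounded_subset)
      ultimately show ?thesis
        using sub \<psi> unfolding test_function_def by blast
    qed
    have gi: "grad (\<lambda>x. Q i x * \<psi> x) x $ i = Q i x * grad \<psi> x $ i + 2 * a i * \<psi> x" for i x
      unfolding grad_eqI[OF D] by (simp add: mult.commute)
    have "0 = (\<Sum>i\<in>UNIV. LINT x|lebesgue. grad (\<lambda>x. Q i x * \<psi> x) x $ i)"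
      using integral_grad_component_zero(2)[OF T] by simp
    also have "\<dots> = (LINT x|lebesgue. (\<Sum>i\<in>UNIV. grad (\<lambda>x. Q i x * \<psi> x) x $ i))"
      by (subst Bochner_Integration.integral_sum) (use integral_grad_component_zero(1)[OF T] in auto)
    also have "\<dots> = (LINT x|lebesgue. grad (diag_quadratic p c a b) x \<bullet> grad \<psi> x
        + (\<Sum>i\<in>UNIV. 2 * a i) * \<psi> x)"
      unfolding gi g by (simp add: inner_vec_def sum.distrib sum_distrib_right)
    also have "\<dots> = (LINT x|lebesgue. grad (diag_quadratic p c a b) x \<bullet> grad \<psi> x)
        + (LINT x|lebesgue. (\<Sum>i\<in>UNIV. 2 * a i) * \<psi> x)"
      using i1 i2 by (intro Bochner_Integration.integral_add) auto
    finally show ?thesis by simp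
  qed
  moreover have "locally_integrable_on U (\<lambda>x. - (\<Sum>i\<in>UNIV. 2 * a i))"
    unfolding locally_integrable_on_def set_integrable_def
    using integrable_completion borel_integrable_compact[OF _ continuous_on_const]
    by (metis borel_measurable_integrable)
  ultimately show ?thesis using C unfolding weak_solution_def by blast
qed

section \<open>Reflections in coordinate hyperplanes\<close>

definition reflect :: "'n \<Rightarrow> real ^ 'n \<Rightarrow> real ^ 'n \<Rightarrow> real ^ 'n" where
  "reflect i p x = x - (2 * (x $ i - p $ i)) *\<^sub>R axis i 1"

lemma reflect_nth: "reflect i p x $ j = (if j = i then 2 * p $ i - x $ i else x $ j)"
  by (simp add: reflect_def axis_def)

lemma reflect_reflect [simp]: "reflect i p (reflect i p x) = x"
  by (simp add: vec_eq_iff reflect_nth)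

lemma continuous_on_reflect: "continuous_on S (reflect i p)"
  unfolding reflect_def by (intro continuous_intros)

lemma inner_reflect_0: "reflect i 0 a \<bullet> b = a \<bullet> reflect i 0 b"
  unfolding inner_vec_def by (rule sum.cong) (auto simp: reflect_nth)

lemma has_derivative_reflect: "(reflect i p has_derivative reflect i 0) (at x)"
proof -
  have "reflect i p = (\<lambda>x. reflect i 0 x + (2 * p $ i) *\<^sub>R axis i 1)"
    by (simp add: fun_eq_iff vec_eq_iff reflect_nth axis_def)
  moreover have "bounded_linear (reflect i 0)"
    by (rule linear_conv_bounded_linear[THEN iffD1], rule linearI)
       (auto simp: vec_eq_iff reflect_nth algebra_simps)
  ultimately show ?thesis
    using has_derivative_add[OF bounded_linear_imp_has_derivative has_derivative_const] by fastforce
qed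

lemma GDERIV_reflect:
  assumes "GDERIV v (reflect i p x) :> a"
  shows "GDERIV (\<lambda>x. v (reflect i p x)) x :> reflect i 0 a"
  using has_derivative_compose[OF has_derivative_reflect assms[unfolded gderiv_def]]
  unfolding gderiv_def inner_reflect_0 .

text \<open>The reflection multiplies one coordinate by \<open>-1\<close> and translates, so the general affine
  transformation rule applies with Jacobian one.\<close>
lemma lebesgue_reflect:
  fixes p :: "real ^ 'n"
  shows measurable_reflect: "reflect i p \<in> lebesgue \<rightarrow>\<^sub>M lebesgue"
    and distr_reflect: "distr lebesgue lebesgue (reflect i p) = lebesgue"
proof -
  define e :: "real ^ 'n" where "e = axis i 1"
  have eB: "e \<in> Basis" unfolding e_def by simp
  let ?c = "\<lambda>j. if j = e then - 1 else (1::real)"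
  have T: "reflect i p = (\<lambda>x. (2 * p $ i) *\<^sub>R e + (\<Sum>j\<in>Basis. (?c j * (x \<bullet> j)) *\<^sub>R j))"
  proof
    fix x
    have "(\<Sum>j\<in>Basis. (?c j * (x \<bullet> j)) *\<^sub>R j)
        = (\<Sum>j\<in>Basis. (x \<bullet> j) *\<^sub>R j - (if j = e then (2 * (x \<bullet> e)) *\<^sub>R e else 0))"
      by (rule sum.cong) (auto simp: scaleR_left_diff_distrib[symmetric])
    also have "\<dots> = x - (2 * (x \<bullet> e)) *\<^sub>R e"
      using eB by (simp only: sum_subtractf euclidean_representation sum.delta finite_Basis if_True)
    finally show "reflect i p x = (2 * p $ i) *\<^sub>R e + (\<Sum>j\<in>Basis. (?c j * (x \<bullet> j)) *\<^sub>R j)"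
      by (simp add: reflect_def e_def inner_axis algebra_simps)
  qed
  have "(\<Prod>j\<in>(Basis::(real^'n) set). \<bar>?c j\<bar>) = 1"
    by (rule prod.neutral) simp
  then have "lebesgue = density (distr lebesgue lebesgue (reflect i p)) (\<lambda>_. 1)"
    using lebesgue_affine_euclidean[of ?c "(2 * p $ i) *\<^sub>R e"] unfolding T by simp
  then show "distr lebesgue lebesgue (reflect i p) = lebesgue"
    by (simp add: density_1)
  show "reflect i p \<in> lebesgue \<rightarrow>\<^sub>M lebesgue"
    using lebesgue_affine_measurable[of ?c "(2 * p $ i) *\<^sub>R e"] unfolding T by simp
qed

lemma integrable_reflect:
  fixes F :: "real ^ 'n \<Rightarrow> real"
  assumes "integrable lebesgue F"
  shows "integrable lebesgue (\<lambda>x. F (reflect i p x))"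
    and "(LINT x|lebesgue. F (reflect i p x)) = (LINT x|lebesgue. F x)"
  using integrable_distr[OF measurable_reflect, of i p F] integral_distr[OF measurable_reflect, of F i p]
    assms borel_measurable_integrable[OF assms]
  unfolding distr_reflect by auto

text \<open>The Laplacian commutes with reflections: transferring the reflection from \<open>v\<close> to the test function
  turns the claim into the equation for \<open>v\<close>.\<close>
lemma weak_solution_reflect:
  fixes p :: "real ^ 'n"
  assumes v: "weak_solution U g v" and V: "reflect i p ` V \<subseteq> U"
  shows "weak_solution V (\<lambda>x. g (reflect i p x)) (\<lambda>x. v (reflect i p x))"
proof -
  let ?R = "reflect i p" and ?S = "reflect i 0"
  have vC: "Ck_on 1 U v" and gl: "locally_integrable_on U g"
    using v unfolding weak_solution_def by auto
  have D: "GDERIV (\<lambda>x. v (?R x)) x :> ?S (grad v (?R x))" if "x \<in> V" for x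
    using that vC V unfolding C1_iff_grad by (intro GDERIV_reflect) auto
  have C: "Ck_on 1 V (\<lambda>x. v (?R x))"
  proof (rule C1_I[OF D])
    have "continuous_on U (grad v)" using vC unfolding C1_iff_grad by simp
    then show "continuous_on V (\<lambda>x. ?S (grad v (?R x)))"
      using V by (intro continuous_on_compose2[OF continuous_on_reflect[of UNIV]]
        continuous_on_compose2[OF _ continuous_on_reflect]) auto
  qed
  have L: "locally_integrable_on V (\<lambda>x. g (?R x))"
    unfolding locally_integrable_on_def set_integrable_def
  proof (intro allI impI)
    fix K assume K: "compact K \<and> K \<subseteq> V"
    have "compact (?R ` K)" "?R ` K \<subseteq> U"
      using K V compact_continuous_image[OF continuous_on_reflect] by blast+
    then have "integrable lebesgue (\<lambda>x. indicator (?R ` K) x *\<^sub>R g x)"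
      using gl unfolding locally_integrable_on_def set_integrable_def by blast
    from integrable_reflect(1)[OF this, of i p]
    have "integrable lebesgue (\<lambda>x. indicator (?R ` K) (?R x) *\<^sub>R g (?R x))" .
    moreover have "indicator (?R ` K) (?R x) = (indicator K x :: real)" for x
      by (metis (no_types, lifting) image_iff indicator_simps reflect_reflect)
    ultimately show "integrable lebesgue (\<lambda>x. indicator K x *\<^sub>R g (?R x))" by simp
  qed
  have "(LINT x|lebesgue. grad (\<lambda>x. v (?R x)) x \<bullet> grad \<psi> x)
      = (LINT x|lebesgue. g (?R x) * \<psi> x)" if \<psi>: "test_function V \<psi>" for \<psi>
  proof -
    let ?K = "closure {x. \<psi> x \<noteq> 0}"
    have D\<psi>: "GDERIV (\<lambda>x. \<psi> (?R x)) x :> ?S (grad \<psi> (?R x))" for x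
      by (rule GDERIV_reflect[OF test_function_C1(1)[OF \<psi>]])
    have T: "test_function U (\<lambda>x. \<psi> (?R x))"
      unfolding test_function_def
    proof (intro conjI)
      show "Ck_on 1 UNIV (\<lambda>x. \<psi> (?R x))"
        by (rule C1_I[OF D\<psi>])
           (intro continuous_on_compose2[OF continuous_on_reflect[of UNIV]]
             continuous_on_compose2[OF test_function_C1(2)[OF \<psi>, of UNIV] continuous_on_reflect], auto)
      have K: "compact (?R ` ?K)" "?R ` ?K \<subseteq> U"
        using \<psi> V compact_continuous_image[OF continuous_on_reflect]
        unfolding test_function_def by blast+
      have "{x. \<psi> (?R x) \<noteq> 0} \<subseteq> ?R ` ?K"
        using closure_subset by (fastforce intro: image_eqI[of _ _ "?R _"])
      then have sub: "closure {x. \<psi> (?R x) \<noteq> 0} \<subseteq> ?R ` ?K"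
        using K(1) by (intro closure_minimal compact_imp_closed)
      show "compact (closure {x. \<psi> (?R x) \<noteq> 0})"
        using sub K(1) by (meson closed_closure compact_eq_bounded_closed bounded_subset)
      show "closure {x. \<psi> (?R x) \<noteq> 0} \<subseteq> U"
        using sub K(2) by blast
    qed
    have eq: "grad (\<lambda>x. v (?R x)) x \<bullet> grad \<psi> x
        = grad v (?R x) \<bullet> grad (\<lambda>x. \<psi> (?R x)) (?R x)" for x
    proof (cases "x \<in> V")
      case True
      then show ?thesis
        unfolding grad_eqI[OF D[OF True]] grad_eqI[OF D\<psi>] by (simp add: inner_reflect_0)
    next
      case False
      then have "grad \<psi> x = 0"
        using test_function_outside(2)[OF \<psi>] \<psi> unfolding test_function_def by blast
      then show ?thesis
        unfolding grad_eqI[OF D\<psi>] reflect_reflect by (simp add: reflect_def)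
    qed
    have "(LINT x|lebesgue. grad (\<lambda>x. v (?R x)) x \<bullet> grad \<psi> x)
        = (LINT x|lebesgue. grad v x \<bullet> grad (\<lambda>x. \<psi> (?R x)) x)"
      unfolding eq by (rule integrable_reflect(2)[OF integrable_grad_test[OF vC T]])
    also have "\<dots> = (LINT x|lebesgue. g x * \<psi> (?R x))"
      using v T unfolding weak_solution_def by blast
    also have "\<dots> = (LINT x|lebesgue. g (?R x) * \<psi> x)"
      using integrable_reflect(2)[OF integrable_times_test[OF gl T], of i p] by simp
    finally show ?thesis .
  qed
  with C L show ?thesis unfolding weak_solution_def by blast
qed

section \<open>An interior gradient bound\<close>

text \<open>Brandt's argument: a derivative is estimated by the maximum principle alone. The antisymmetric part
  $w(x) = (v(x) - v(Rx))/2$, with $R$ the reflection in the hyperplane $x_i = p_i$, vanishes on this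
  hyperplane and satisfies $|w| \<le> M$ and $|\<Delta> w| \<le> B$ in the half cube $0 < x_i - p_i < d$. Write
  $s = x_i - p_i$ and $N$ for the dimension. The quadratic polynomial
  $q(x) = (M/d^2) \<Sum>_{j \<noteq> i} (x_j - p_j)^2 + (M/d) s (N - (N-1) s/d) + (B/2) s (d - s)$
  satisfies $-\<Delta> q = B$, is nonnegative on the face $s = 0$ and at least $M$ on the other faces, so that
  $|w| \<le> q$. Along the $i$-th axis through $p$ the derivative of $w$ at $s = 0$ is the $i$-th partial
  derivative of $v$, and that of $q$ is $N M / d + d B / 2$.\<close>
lemma interior_gradient_bound:
  fixes p :: "real ^ 'n" and v :: "real ^ 'n \<Rightarrow> real" and d M B :: real
  assumes v: "weak_solution U g v"
    and d: "d > 0"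
    and cube: "{x. \<forall>j. \<bar>x $ j - p $ j\<bar> \<le> d} \<subseteq> U"
    and M: "\<And>x. (\<forall>j. \<bar>x $ j - p $ j\<bar> \<le> d) \<Longrightarrow> \<bar>v x\<bar> \<le> M"
    and B: "\<And>x. (\<forall>j. \<bar>x $ j - p $ j\<bar> \<le> d) \<Longrightarrow> \<bar>g x\<bar> \<le> B"
  shows "\<bar>grad v p $ i\<bar> \<le> CARD('n) * M / d + d * B / 2"
proof -
  define N where "N = real CARD('n)"
  have N: "N \<ge> 1" unfolding N_def using zero_less_card_finite[where 'a = 'n] by linarith
  define Q where "Q = {x. \<forall>j. \<bar>x $ j - p $ j\<bar> \<le> d}"
  define lo where "lo = (\<chi> j. if j = i then p $ i else p $ j - d)"
  define hi where "hi = (\<chi> j. p $ j + d)"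
  define H where "H = box lo hi"
  let ?R = "reflect i p"
  have pQ: "p \<in> Q" unfolding Q_def using d by simp
  have M0: "M \<ge> 0" using M[of p] d by force
  have B0: "B \<ge> 0" using B[of p] d by force
  have mem_H: "x \<in> H \<longleftrightarrow> (\<forall>j. j \<noteq> i \<longrightarrow> \<bar>x $ j - p $ j\<bar> < d) \<and> 0 < x $ i - p $ i \<and> x $ i - p $ i < d" for x
    unfolding H_def mem_box_cart lo_def hi_def
    by (simp add: abs_less_iff) (smt (verit, best))
  have mem_cbox: "x \<in> cbox lo hi \<longleftrightarrow> (\<forall>j. j \<noteq> i \<longrightarrow> \<bar>x $ j - p $ j\<bar> \<le> d) \<and> 0 \<le> x $ i - p $ i \<and> x $ i - p $ i \<le> d" for x
    unfolding mem_box_cart lo_def hi_def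
    by (simp add: abs_le_iff) (smt (verit, best))
  have cQ: "cbox lo hi \<subseteq> Q"
  proof
    fix x assume "x \<in> cbox lo hi"
    then have "\<bar>x $ j - p $ j\<bar> \<le> d" for j
      unfolding mem_cbox by (cases "j = i") auto
    then show "x \<in> Q" unfolding Q_def by blast
  qed
  have RQ: "?R x \<in> Q" if "x \<in> Q" for x
    using that unfolding Q_def mem_Collect_eq reflect_nth
    by (smt (verit, best))
  have QU: "Q \<subseteq> U" using cube unfolding Q_def .
  have HQ: "H \<subseteq> Q" using cQ box_subset_cbox unfolding H_def by blast
  have "(p + (d / 2) *\<^sub>R axis i 1) \<in> H"
    using d unfolding mem_H by (auto simp: axis_def)
  then have Hne: "box lo hi \<noteq> {}" unfolding H_def by blast
  have vU: "continuous_on U v"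
    using v C1_continuous_on unfolding weak_solution_def by blast
  \<comment> \<open>The barrier, expanded in powers of the coordinates; its linear coefficient is the
      asserted bound.\<close>
  define K where "K = N * M / d + d * B / 2"
  define a where "a j = (if j = i then - ((N - 1) * M / d\<^sup>2) - B / 2 else M / d\<^sup>2)" for j
  define b where "b j = (if j = i then K else 0)" for j :: 'n
  define q where "q = diag_quadratic p 0 a b"
  have suma: "(\<Sum>j\<in>UNIV. 2 * a j) = - B"
  proof -
    have "(\<Sum>j\<in>UNIV. 2 * a j) = 2 * a i + (\<Sum>j\<in>UNIV - {i}. 2 * a j)"
      by (rule sum.remove) auto
    also have "(\<Sum>j\<in>UNIV - {i}. 2 * a j) = (\<Sum>j\<in>UNIV - {i}. 2 * (M / d\<^sup>2))"
      by (rule sum.cong) (auto simp: a_def)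
    also have "\<dots> = 2 * ((N - 1) * M / d\<^sup>2)"
      by (simp add: N_def card_Diff_singleton of_nat_diff)
    finally show ?thesis unfolding a_def by simp
  qed
  have q_eq: "q x = M / d\<^sup>2 * (\<Sum>j\<in>UNIV - {i}. (x $ j - p $ j)\<^sup>2)
      + M / d * (x $ i - p $ i) * (N - (N - 1) * (x $ i - p $ i) / d)
      + B / 2 * (x $ i - p $ i) * (d - (x $ i - p $ i))" for x
  proof -
    define s where "s = x $ i - p $ i"
    have "q x = (a i * s\<^sup>2 + b i * s)
        + (\<Sum>j\<in>UNIV - {i}. a j * (x $ j - p $ j)\<^sup>2 + b j * (x $ j - p $ j))"
      unfolding q_def diag_quadratic_def s_def
      by (subst sum.remove[of UNIV i]) auto
    also have "(\<Sum>j\<in>UNIV - {i}. a j * (x $ j - p $ j)\<^sup>2 + b j * (x $ j - p $ j))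
        = (\<Sum>j\<in>UNIV - {i}. M / d\<^sup>2 * (x $ j - p $ j)\<^sup>2)"
      by (rule sum.cong) (auto simp: a_def b_def)
    also have "\<dots> = M / d\<^sup>2 * (\<Sum>j\<in>UNIV - {i}. (x $ j - p $ j)\<^sup>2)"
      by (simp add: sum_distrib_left)
    also have "a i * s\<^sup>2 + b i * s = M / d * s * (N - (N - 1) * s / d) + B / 2 * s * (d - s)"
      unfolding a_def b_def K_def using d by (simp add: field_simps power2_eq_square)
    finally show ?thesis unfolding s_def by simp
  qed
  have q_nonneg: "0 \<le> q x" and q_ge: "(\<exists>j. \<bar>x $ j - p $ j\<bar> = d) \<Longrightarrow> M \<le> q x"
    if x: "x \<in> cbox lo hi" for x
  proof -
    define s where "s = x $ i - p $ i"
    have s: "0 \<le> s" "s \<le> d" using x unfolding mem_cbox s_def by auto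
    have t1: "0 \<le> M / d\<^sup>2 * (\<Sum>j\<in>UNIV - {i}. (x $ j - p $ j)\<^sup>2)"
      using M0 by (simp add: sum_nonneg)
    have "(N - 1) * s \<le> (N - 1) * d" using s N by (intro mult_left_mono) auto
    then have "(N - 1) * s / d \<le> N - 1" using d by (simp add: divide_le_eq)
    then have "M / d * s * 1 \<le> M / d * s * (N - (N - 1) * s / d)"
      using M0 d s by (intro mult_left_mono) auto
    then have t2: "M / d * s \<le> M / d * s * (N - (N - 1) * s / d)" by simp
    have t2': "0 \<le> M / d * s" using M0 d s by simp
    have t3: "0 \<le> B / 2 * s * (d - s)" using B0 s by simp
    show "0 \<le> q x" using t1 t2 t2' t3 unfolding q_eq s_def[symmetric] by linarith
    assume "\<exists>j. \<bar>x $ j - p $ j\<bar> = d"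
    then obtain j where j: "\<bar>x $ j - p $ j\<bar> = d" by blast
    show "M \<le> q x"
    proof (cases "j = i")
      case True
      then have "s = d" using j s unfolding s_def by auto
      then have "M / d * s = M" using d by simp
      then show ?thesis using t1 t2 t3 unfolding q_eq s_def[symmetric] by linarith
    next
      case False
      then have "(x $ j - p $ j)\<^sup>2 \<le> (\<Sum>j\<in>UNIV - {i}. (x $ j - p $ j)\<^sup>2)"
        by (intro member_le_sum) auto
      moreover have "(x $ j - p $ j)\<^sup>2 = d\<^sup>2" using j by (metis power2_abs)
      ultimately have "M / d\<^sup>2 * d\<^sup>2 \<le> M / d\<^sup>2 * (\<Sum>j\<in>UNIV - {i}. (x $ j - p $ j)\<^sup>2)"
        using M0 by (intro mult_left_mono) auto
      then show ?thesis using d t2 t2' t3 unfolding q_eq s_def[symmetric] by simp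
    qed
  qed
  have qws: "weak_solution H (\<lambda>x. B) q"
    using weak_solution_diag_quadratic[of H a p 0 b] unfolding suma q_def by simp
  have vH: "weak_solution H g v"
    using weak_solution_subset[OF v] HQ QU by blast
  have RH: "?R ` H \<subseteq> U" using RQ HQ QU by blast
  have vR: "weak_solution H (\<lambda>x. g (?R x)) (\<lambda>x. v (?R x))"
    by (rule weak_solution_reflect[OF v RH])
  have qc: "continuous_on S q" for S
    unfolding q_def diag_quadratic_def by (intro continuous_intros)
  have main: "\<sigma> * (v x - v (?R x)) / 2 \<le> q x" if \<sigma>: "\<bar>\<sigma>\<bar> = 1" and x: "x \<in> H" for \<sigma> x
  proof -
    let ?w = "\<lambda>x. \<sigma> / 2 * v x + - (\<sigma> / 2) * v (?R x)"
    let ?g = "\<lambda>x. \<sigma> / 2 * g x + - (\<sigma> / 2) * g (?R x)"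
    have \<sigma>: "\<sigma> = 1 \<or> \<sigma> = - 1" using \<sigma> by linarith
    \<comment> \<open>The sign \<open>\<sigma>\<close> covers both one-sided bounds at once.\<close>
    have half: "\<sigma> / 2 * s + - (\<sigma> / 2) * t \<le> C" if "\<bar>s\<bar> \<le> C" "\<bar>t\<bar> \<le> C" for s t C
      using \<sigma> that by auto
    have "?w x \<le> q x"
    proof (rule weak_comparison)
      show "open H" "bounded H" unfolding H_def by (simp_all add: open_box bounded_box)
      show "weak_solution H ?g ?w"
        by (intro weak_solution_lincomb vH vR)
      show "weak_solution H (\<lambda>x. B) q" by (rule qws)
      show "?g y \<le> B" if "y \<in> H" for y
        using half[of "g y" B "g (?R y)"] B[of y] B[of "?R y"] RQ[of y] HQ that
        unfolding Q_def by auto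
      have "continuous_on (cbox lo hi) (\<lambda>x. v (?R x))"
        by (rule continuous_on_compose2[OF vU continuous_on_reflect]) (use RQ cQ QU in blast)
      moreover have "continuous_on (cbox lo hi) v"
        using continuous_on_subset[OF vU] cQ QU by blast
      ultimately show "continuous_on (closure H) ?w"
        unfolding H_def closure_box[OF Hne] by (intro continuous_intros)
      show "?w y \<le> q y" if "y \<in> frontier H" for y
      proof -
        have y: "y \<in> cbox lo hi" "y \<notin> H"
          using that Hne unfolding H_def frontier_box by auto
        have "y $ i - p $ i = 0 \<or> (\<exists>j. \<bar>y $ j - p $ j\<bar> = d)"
        proof (rule ccontr)
          assume "\<not> ?thesis"
          then have *: "y $ i - p $ i \<noteq> 0" "\<And>j. \<bar>y $ j - p $ j\<bar> \<noteq> d" by auto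
          have "\<bar>y $ j - p $ j\<bar> < d" if "j \<noteq> i" for j
            using y(1) *(2)[of j] that unfolding mem_cbox by force
          moreover have "0 < y $ i - p $ i" "y $ i - p $ i < d"
            using y(1) *(1) *(2)[of i] unfolding mem_cbox by auto
          ultimately show False using y(2) unfolding mem_H by blast
        qed
        then consider "y $ i - p $ i = 0" | "\<exists>j. \<bar>y $ j - p $ j\<bar> = d" by blast
        then show ?thesis
        proof cases
          case 1
          then have "?R y = y" by (simp add: reflect_def)
          then show ?thesis using q_nonneg[OF y(1)] by simp
        next
          case 2
          have "\<sigma> / 2 * v y + - (\<sigma> / 2) * v (?R y) \<le> M"
            using half M RQ[of y] cQ y(1) unfolding Q_def by auto
          then show ?thesis using q_ge[OF y(1) 2] by simp
        qed
      qed
    qed (rule qc, rule x)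
    then show ?thesis by (simp add: algebra_simps diff_divide_distrib)
  qed
  have "\<sigma> * (grad v p $ i) \<le> K" if \<sigma>: "\<bar>\<sigma>\<bar> = 1" for \<sigma>
  proof (rule ccontr)
    assume neg: "\<not> \<sigma> * (grad v p $ i) \<le> K"
    define e :: "real ^ 'n" where "e = axis i 1"
    \<comment> \<open>If the slope at zero were larger than \<open>K\<close>, the function would be positive just inside the
        half cube, where the barrier forces it to be nonpositive.\<close>
    define k where "k t = \<sigma> * (v (p + t *\<^sub>R e) - v (p + t *\<^sub>R (- e))) / 2 - K * t" for t
    have G: "GDERIV v p :> grad v p"
      using v pQ QU C1_D(1) unfolding weak_solution_def by blast
    have ei: "e \<bullet> grad v p = grad v p $ i" unfolding e_def by (simp add: inner_axis')
    have "(k has_real_derivative \<sigma> * (e \<bullet> grad v p - (- e) \<bullet> grad v p) / 2 - K * 1) (at 0)"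
      unfolding k_def
      by (intro DERIV_diff DERIV_cdivide DERIV_cmult GDERIV_imp_directional[OF G] DERIV_ident)
    moreover have "\<sigma> * (e \<bullet> grad v p - (- e) \<bullet> grad v p) / 2 - K * 1 > 0"
      using neg ei by simp
    ultimately obtain \<delta> where \<delta>: "\<delta> > 0" "\<And>h. 0 < h \<Longrightarrow> h < \<delta> \<Longrightarrow> k 0 < k (0 + h)"
      using DERIV_pos_inc_right[of k _ 0] by blast
    define h where "h = min \<delta> d / 2"
    have h: "0 < h" "h < \<delta>" "h < d" using \<delta> d unfolding h_def by auto
    define x where "x = p + h *\<^sub>R e"
    have xi: "x $ j - p $ j = (if j = i then h else 0)" for j
      unfolding x_def e_def by (simp add: axis_def)
    have xH: "x \<in> H" unfolding mem_H xi using h d by simp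
    have R: "?R x = p + h *\<^sub>R (- e)"
      unfolding x_def e_def by (simp add: vec_eq_iff reflect_nth axis_def)
    have "q x = M / d * h * (N - (N - 1) * h / d) + B / 2 * h * (d - h)"
      unfolding q_eq xi by simp
    also have "\<dots> = K * h - ((N - 1) * M / d\<^sup>2 + B / 2) * h\<^sup>2"
      unfolding K_def using d by (simp add: field_simps power2_eq_square)
    also have "\<dots> \<le> K * h"
      using N M0 B0 by simp
    finally have "k h \<le> 0"
      using main[OF \<sigma> xH] R unfolding k_def x_def by simp
    moreover have "k 0 = 0" unfolding k_def by simp
    ultimately show False using \<delta>(2)[of h] h by simp
  qed
  from this[of 1] this[of "- 1"] show ?thesis
    unfolding K_def N_def by simp
qed

section \<open>Positivity of the torsion function\<close>

lemma weak_solution_const: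
  fixes U :: "(real ^ 'n) set"
  shows "weak_solution U (\<lambda>x. 0) (\<lambda>x. c)"
proof -
  have "diag_quadratic (0 :: real ^ 'n) c (\<lambda>_. 0) (\<lambda>_. 0) = (\<lambda>x. c)"
    by (simp add: diag_quadratic_def fun_eq_iff)
  then show ?thesis
    using weak_solution_diag_quadratic[of U "\<lambda>_. 0" 0 c "\<lambda>_. 0"] by simp
qed

text \<open>Comparison with zero gives \<open>\<phi> \<ge> 0\<close>. In a closed ball in \<open>U\<close> of radius \<open>r\<close> about \<open>x\<close>, comparison with the explicit torsion
  function of the ball, the paraboloid $(r^2 - |y - x|^2)/(2N)$, then gives $\<phi>(x) \<ge> r^2/(2N)$.\<close>
lemma torsion_function_positive:
  fixes \<phi> :: "real ^ 'n \<Rightarrow> real"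
  assumes U: "open U" "bounded U"
    and \<phi>: "weak_solution U (\<lambda>x. 1) \<phi>"
    and cont: "continuous_on (closure U) \<phi>"
    and bd: "\<And>x. x \<in> frontier U \<Longrightarrow> \<phi> x = 0"
    and x: "x \<in> U"
  shows "0 < \<phi> x"
proof -
  have nonneg: "0 \<le> \<phi> y" if "y \<in> U" for y
    by (rule weak_comparison[OF U weak_solution_const \<phi> _ _ cont _ that])
       (use bd in auto)
  obtain r where r: "r > 0" "cball x r \<subseteq> U"
    using U(1) x open_contains_cball by blast
  define N where "N = real CARD('n)"
  have N: "N > 0" unfolding N_def by simp
  define q where "q = diag_quadratic x (r\<^sup>2 / (2 * N)) (\<lambda>_. - 1 / (2 * N)) (\<lambda>_. 0)"
  have q_eq: "q y = (r\<^sup>2 - (dist x y)\<^sup>2) / (2 * N)" for y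
  proof -
    have "(dist x y)\<^sup>2 = (\<Sum>i\<in>UNIV. (y $ i - x $ i)\<^sup>2)"
      unfolding dist_norm power2_norm_eq_inner inner_vec_def
      by (rule sum.cong) (auto simp: power2_eq_square algebra_simps)
    then show ?thesis
      unfolding q_def diag_quadratic_def
      by (simp add: sum_negf sum_divide_distrib[symmetric] diff_divide_distrib)
  qed
  have qW: "weak_solution (ball x r) (\<lambda>x. 1) q"
    using weak_solution_diag_quadratic[of "ball x r" "\<lambda>_. - 1 / (2 * N)" x "r\<^sup>2 / (2 * N)" "\<lambda>_. 0"] N
    unfolding q_def by (simp add: N_def)
  have qc: "continuous_on S q" for S
    unfolding q_def diag_quadratic_def by (intro continuous_intros)
  have "q x \<le> \<phi> x"
  proof (rule weak_comparison[OF open_ball bounded_ball qW])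
    have b: "ball x r \<subseteq> U" using r(2) ball_subset_cball by blast
    show "weak_solution (ball x r) (\<lambda>x. 1) \<phi>"
      by (rule weak_solution_subset[OF \<phi> b])
    have "closure (ball x r) \<subseteq> closure U" by (rule closure_mono[OF b])
    then show "continuous_on (closure (ball x r)) \<phi>"
      by (rule continuous_on_subset[OF cont])
    show "q y \<le> \<phi> y" if "y \<in> frontier (ball x r)" for y
    proof -
      have "dist x y = r" using that r(1) by (simp add: frontier_ball)
      then show ?thesis using nonneg[of y] r(2) by (auto simp: q_eq)
    qed
  qed (use r qc in auto)
  moreover have "q x > 0" using r N by (simp add: q_eq)
  ultimately show ?thesis by linarith
qed

section \<open>The asymptotic expansion\<close>

lemma cube_subset_cball:
  fixes p :: "real ^ 'n"
  assumes "\<And>j. \<bar>x $ j - p $ j\<bar> \<le> r / CARD('n)"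
  shows "x \<in> cball p r"
proof -
  have "norm (x - p) \<le> (\<Sum>j\<in>UNIV. \<bar>(x - p) $ j\<bar>)" by (rule norm_le_l1_cart)
  also have "\<dots> \<le> (\<Sum>j\<in>(UNIV::'n set). r / CARD('n))"
    using assms by (intro sum_mono) simp
  also have "\<dots> = r" by simp
  finally show ?thesis by (simp add: dist_norm norm_minus_commute)
qed

theorem theorem1p7:
  fixes \<Omega> :: "(real ^ 'n) set"
    and f :: "real \<Rightarrow> real" and c\<^sub>0 :: real
    and u :: "real \<Rightarrow> real ^ 'n \<Rightarrow> real" and \<phi> :: "real ^ 'n \<Rightarrow> real"
  assumes "CARD('n) \<ge> 2"
    and "smooth_bounded_domain \<Omega>"
    and "\<And>t. 0 \<le> f t" and "mono f" and "0 < f 0"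
    and "C1_within {t. 0 < f t \<and> f t < f 0} f"
    and "(f \<longlongrightarrow> c\<^sub>0) at_bot" and "0 < c\<^sub>0"
    and "\<And>l. l < 0 \<Longrightarrow> negative_solution \<Omega> f l (u l)"
    and "dirichlet_solution \<Omega> (\<lambda>x. 1) \<phi>"
  shows "tendsto_C1_loc \<Omega> (\<lambda>l x. u l x / l) (\<lambda>x. c\<^sub>0 * \<phi> x) at_bot"
proof -
  have \<Omega>: "open \<Omega>" "bounded \<Omega>"
    using assms(2) unfolding smooth_bounded_domain_def by auto
  have \<phi>W: "weak_solution \<Omega> (\<lambda>x. 1) \<phi>"
    by (rule dirichlet_imp_weak_solution[OF assms(10)])
  have \<phi>c: "continuous_on (closure \<Omega>) \<phi>" and \<phi>0: "\<And>x. x \<in> frontier \<Omega> \<Longrightarrow> \<phi> x = 0"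
    using assms(10) unfolding dirichlet_solution_def by auto
  have \<phi>pos: "0 < \<phi> x" if "x \<in> \<Omega>" for x
    by (rule torsion_function_positive[OF \<Omega> \<phi>W \<phi>c \<phi>0 that])
  have "bounded (\<phi> ` closure \<Omega>)"
    using \<Omega>(2) \<phi>c by (intro compact_imp_bounded compact_continuous_image) auto
  then obtain \<Phi> where \<Phi>: "\<Phi> > 0" "\<And>x. x \<in> \<Omega> \<Longrightarrow> \<phi> x \<le> \<Phi>"
    unfolding bounded_pos using closure_subset[of \<Omega>] by (auto simp: abs_le_iff)
  have f_ge: "c\<^sub>0 \<le> f t" for t
  proof (rule tendsto_upperbound[OF assms(7)])
    show "\<forall>\<^sub>F s in at_bot. f s \<le> f t"
      using eventually_le_at_bot[of t] by eventually_elim (use assms(4) in \<open>auto dest: monoD\<close>)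
  qed simp
  \<comment> \<open>The summand \<open>1\<close> makes the bound strictly positive also when \<open>f 0 = c\<^sub>0\<close>.\<close>
  define M where "M = f 0 - c\<^sub>0 + 1"
  have M: "M > 0" using f_ge[of 0] unfolding M_def by simp
  define w where "w l x = u l x / l" for l x
  define v where "v l x = w l x - c\<^sub>0 * \<phi> x" for l x
  define h where "h l x = f (u l x) - c\<^sub>0" for l x
  have c\<phi>W: "weak_solution \<Omega> (\<lambda>x. c\<^sub>0) (\<lambda>x. c\<^sub>0 * \<phi> x)"
    using weak_solution_lincomb[OF \<phi>W weak_solution_const, of c\<^sub>0 0 0] by simp
  have uD: "dirichlet_solution \<Omega> (\<lambda>x. l * f (u l x)) (u l)" and uneg: "x \<in> \<Omega> \<Longrightarrow> u l x < 0"
    if "l < 0" for l x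
    using assms(9)[OF that] unfolding negative_solution_def by auto
  have wW: "weak_solution \<Omega> (\<lambda>x. f (u l x)) (w l)" if "l < 0" for l
    using weak_solution_lincomb[OF dirichlet_imp_weak_solution[OF uD[OF that]]
        weak_solution_const, of "1 / l" 0 0] that
    unfolding w_def by simp
  have vW: "weak_solution \<Omega> (h l) (v l)" if "l < 0" for l
    using weak_solution_lincomb[OF wW[OF that] c\<phi>W, of 1 "- 1"]
    unfolding v_def h_def by simp
  have vc: "continuous_on (closure \<Omega>) (v l)" and v0: "x \<in> frontier \<Omega> \<Longrightarrow> v l x = 0"
    if "l < 0" for l x
    using uD[OF that] \<phi>0[of x] that unfolding dirichlet_solution_def v_def w_def
    by (auto intro!: continuous_intros \<phi>c)
  have h: "0 \<le> h l x" "x \<in> \<Omega> \<Longrightarrow> h l x \<le> M" if "l < 0" for l x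
  proof -
    show "0 \<le> h l x" unfolding h_def using f_ge by simp
    assume "x \<in> \<Omega>"
    then have "f (u l x) \<le> f 0" using uneg[OF that] assms(4) by (auto dest: monoD less_imp_le)
    then show "h l x \<le> M" unfolding h_def M_def by simp
  qed
  have v_nonneg: "0 \<le> v l x" if "l < 0" "x \<in> \<Omega>" for l x
    by (rule weak_comparison[OF \<Omega> weak_solution_const vW[OF that(1)] _ _ vc[OF that(1)] _ that(2)])
       (use h v0 that in auto)
  have M\<phi>W: "weak_solution \<Omega> (\<lambda>x. M) (\<lambda>x. M * \<phi> x)"
    using weak_solution_lincomb[OF \<phi>W weak_solution_const, of M 0 0] by simp
  have v_le: "v l x \<le> M * \<phi> x" if "l < 0" "x \<in> \<Omega>" for l x
    by (rule weak_comparison[OF \<Omega> vW[OF that(1)] M\<phi>W _ vc[OF that(1)] _ _ that(2)])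
       (use h v0 \<phi>0 that in \<open>auto intro!: continuous_intros \<phi>c\<close>)
  \<comment> \<open>Since \<open>v l\<close> is nonnegative, \<open>u l \<le> l * c\<^sub>0 * \<phi>\<close>: where \<open>\<phi>\<close> is bounded below, \<open>u l\<close> is driven to
      minus infinity and \<open>f (u l)\<close> to its limit.\<close>
  have far: "\<forall>\<^sub>F l in at_bot. l < 0 \<and> (\<forall>x\<in>\<Omega>. m \<le> \<phi> x \<longrightarrow> h l x \<le> \<epsilon>)"
    if "m > 0" "\<epsilon> > 0" for m \<epsilon>
  proof -
    have "\<forall>\<^sub>F t in at_bot. f t < c\<^sub>0 + \<epsilon>"
      using order_tendstoD(2)[OF assms(7)] that(2) by simp
    then obtain T where T: "\<And>t. t \<le> T \<Longrightarrow> f t < c\<^sub>0 + \<epsilon>"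
      unfolding eventually_at_bot_linorder by blast
    show ?thesis
      using eventually_gt_at_bot[of 0] eventually_le_at_bot[of "T / (c\<^sub>0 * m)"]
    proof eventually_elim
      case (elim l)
      have "h l x \<le> \<epsilon>" if x: "x \<in> \<Omega>" "m \<le> \<phi> x" for x
      proof -
        have "c\<^sub>0 * m \<le> c\<^sub>0 * \<phi> x" using x assms(8) by simp
        also have "\<dots> \<le> u l x / l"
          using v_nonneg[OF elim(1) x(1)] unfolding v_def w_def by simp
        finally have "u l x \<le> l * (c\<^sub>0 * m)"
          using elim(1) by (simp add: neg_le_divide_eq mult.commute)
        also have "\<dots> \<le> T"
          using elim(2) assms(8) \<open>m > 0\<close> by (simp add: pos_le_divide_eq)
        finally show ?thesis using T unfolding h_def by force
      qed
      with elim(1) show ?case by blast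
    qed
  qed
  \<comment> \<open>The barrier is \<open>\<delta> * \<phi> + \<eta>\<close>. Where \<open>v l\<close> exceeds it, \<open>M * \<phi> > \<eta>\<close>, so the right-hand side is already small
      there; the boundary layer, where it is not small, is taken care of by \<open>v l \<le> M * \<phi>\<close>.\<close>
  have v_small: "\<forall>\<^sub>F l in at_bot. \<forall>x\<in>\<Omega>. \<bar>v l x\<bar> \<le> \<epsilon>" if \<epsilon>: "\<epsilon> > 0" for \<epsilon>
  proof -
    define \<eta> where "\<eta> = \<epsilon> / 2"
    define \<delta> where "\<delta> = \<epsilon> / (2 * \<Phi>)"
    have pos: "\<eta> > 0" "\<delta> > 0" using \<epsilon> \<Phi> unfolding \<eta>_def \<delta>_def by auto
    have bW: "weak_solution \<Omega> (\<lambda>x. \<delta>) (\<lambda>x. \<delta> * \<phi> x + \<eta>)"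
      using weak_solution_lincomb[OF \<phi>W weak_solution_const, of \<delta> 1 \<eta>] by simp
    have "\<forall>\<^sub>F l in at_bot. l < 0 \<and> (\<forall>x\<in>\<Omega>. \<eta> / M \<le> \<phi> x \<longrightarrow> h l x \<le> \<delta>)"
      using far pos M by simp
    then show ?thesis
    proof eventually_elim
      case (elim l)
      then have l: "l < 0" and hl: "\<And>x. x \<in> \<Omega> \<Longrightarrow> \<eta> / M \<le> \<phi> x \<Longrightarrow> h l x \<le> \<delta>" by auto
      show ?case
      proof
        fix x assume x: "x \<in> \<Omega>"
        have "v l x \<le> \<delta> * \<phi> x + \<eta>"
        proof (rule weak_comparison[OF \<Omega> vW[OF l] bW _ vc[OF l] _ _ x])
          fix y assume y: "y \<in> \<Omega>" "\<delta> * \<phi> y + \<eta> < v l y"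
          have "0 < \<delta> * \<phi> y" using pos \<phi>pos[OF y(1)] by simp
          then have "\<eta> \<le> M * \<phi> y" using y(2) v_le[OF l y(1)] by linarith
          then show "h l y \<le> \<delta>"
            using M by (intro hl[OF y(1)]) (simp add: pos_divide_le_eq mult.commute)
        qed (use v0[OF l] \<phi>0 pos in \<open>auto intro!: continuous_intros \<phi>c\<close>)
        also have "\<dots> \<le> \<delta> * \<Phi> + \<eta>" using \<Phi>(2)[OF x] pos by simp
        also have "\<dots> = \<epsilon>" unfolding \<delta>_def \<eta>_def using \<Phi>(1) by simp
        finally show "\<bar>v l x\<bar> \<le> \<epsilon>" using v_nonneg[OF l x] by simp
      qed
    qed
  qed
  have neg: "\<forall>\<^sub>F l in at_bot. l < (0::real)" by (rule eventually_gt_at_bot)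
  have wC: "Ck_on 1 \<Omega> (w l)" if "l < 0" for l
    using wW[OF that] unfolding weak_solution_def by simp
  have c\<phi>C: "Ck_on 1 \<Omega> (\<lambda>x. c\<^sub>0 * \<phi> x)"
    using c\<phi>W unfolding weak_solution_def by simp
  have grad_v: "grad (v l) x = grad (w l) x - grad (\<lambda>x. c\<^sub>0 * \<phi> x) x" if "l < 0" "x \<in> \<Omega>" for l x
    unfolding v_def
    by (rule grad_eqI[OF GDERIV_diff[OF C1_D(1)[OF wC[OF that(1)] that(2)] C1_D(1)[OF c\<phi>C that(2)]]])
  have val: "uniform_limit K w (\<lambda>x. c\<^sub>0 * \<phi> x) at_bot" if K: "K \<subseteq> \<Omega>" for K
    unfolding uniform_limit_iff
  proof (intro allI impI)
    fix e :: real assume e: "e > 0"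
    then have "\<forall>\<^sub>F l in at_bot. \<forall>x\<in>\<Omega>. \<bar>v l x\<bar> \<le> e / 2" by (intro v_small) simp
    then show "\<forall>\<^sub>F l in at_bot. \<forall>x\<in>K. dist (w l x) (c\<^sub>0 * \<phi> x) < e"
      by eventually_elim (use K e in \<open>fastforce simp: dist_real_def v_def\<close>)
  qed
  have gr: "uniform_limit K (\<lambda>l. grad (w l)) (grad (\<lambda>x. c\<^sub>0 * \<phi> x)) at_bot"
    if K: "compact K" "K \<subseteq> \<Omega>" for K
  proof -
    obtain r where r: "r > 0" "(\<Union>x\<in>K. cball x r) \<subseteq> \<Omega>"
      using compact_subset_open_imp_cball_epsilon_subset[OF K(1) \<Omega>(1) K(2)] by blast
    \<comment> \<open>The gradient bound on \<open>K\<close> uses the equation on a compact neighbourhood of \<open>K\<close>.\<close>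
    define K' where "K' = {x + y |x y. x \<in> K \<and> y \<in> cball 0 r}"
    have K': "compact K'" unfolding K'_def by (rule compact_sums[OF K(1) compact_cball])
    have cb: "cball p r \<subseteq> K'" if "p \<in> K" for p
    proof
      fix x assume "x \<in> cball p r"
      then have "x = p + (x - p)" "x - p \<in> cball 0 r" by (auto simp: dist_norm norm_minus_commute)
      then show "x \<in> K'" unfolding K'_def using that by blast
    qed
    have K'\<Omega>: "K' \<subseteq> \<Omega>"
    proof
      fix z assume "z \<in> K'"
      then obtain x y where "x \<in> K" "z = x + y" "norm y \<le> r" unfolding K'_def by auto
      then have "z \<in> cball x r" by (simp add: dist_norm)
      then show "z \<in> \<Omega>" using r(2) \<open>x \<in> K\<close> by blast
    qed
    obtain m where m: "m > 0" "\<And>x. x \<in> K' \<Longrightarrow> m \<le> \<phi> x"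
    proof (cases "K' = {}")
      case True
      then show thesis by (intro that[of 1]) auto
    next
      case False
      have "continuous_on K' \<phi>"
        using \<phi>c K'\<Omega> closure_subset by (blast intro: continuous_on_subset)
      from continuous_attains_inf[OF K' False this]
      obtain x where "x \<in> K'" "\<forall>y\<in>K'. \<phi> x \<le> \<phi> y" by blast
      then show thesis using K'\<Omega> \<phi>pos by (intro that[of "\<phi> x"]) auto
    qed
    define N where "N = real CARD('n)"
    have N: "N > 0" unfolding N_def by simp
    define d where "d = r / N"
    have d: "d > 0" using r N unfolding d_def by simp
    define A where "A = N * (N / d + d / 2)"
    have A: "A > 0" unfolding A_def using N d by (simp add: add_pos_pos)
    show ?thesis
      unfolding uniform_limit_iff
    proof (intro allI impI)
      fix e :: real assume e: "e > 0"
      define \<epsilon> where "\<epsilon> = e / (2 * A)"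
      have \<epsilon>: "\<epsilon> > 0" using e A unfolding \<epsilon>_def by simp
      show "\<forall>\<^sub>F l in at_bot. \<forall>p\<in>K. dist (grad (w l) p) (grad (\<lambda>x. c\<^sub>0 * \<phi> x) p) < e"
        using far[OF m(1) \<epsilon>] v_small[OF \<epsilon>]
      proof eventually_elim
        case (elim l)
        then have l: "l < 0" by blast
        show ?case
        proof
          fix p assume p: "p \<in> K"
          have cube: "x \<in> K'" if "\<forall>j. \<bar>x $ j - p $ j\<bar> \<le> d" for x
            using cube_subset_cball[of x p r] that cb[OF p] unfolding d_def N_def by blast
          have "\<bar>grad (v l) p $ i\<bar> \<le> N * \<epsilon> / d + d * \<epsilon> / 2" for i
            unfolding N_def
          proof (rule interior_gradient_bound[OF vW[OF l] d])
            show "{x. \<forall>j. \<bar>x $ j - p $ j\<bar> \<le> d} \<subseteq> \<Omega>" using cube K'\<Omega> by blast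
            fix x assume "\<forall>j. \<bar>x $ j - p $ j\<bar> \<le> d"
            then have x: "x \<in> K'" "x \<in> \<Omega>" using cube K'\<Omega> by auto
            show "\<bar>v l x\<bar> \<le> \<epsilon>" using elim(2) x by blast
            show "\<bar>h l x\<bar> \<le> \<epsilon>" using elim(1) m(2) x h(1)[OF l, of x] by auto
          qed
          then have "(\<Sum>i\<in>UNIV. \<bar>grad (v l) p $ i\<bar>) \<le> (\<Sum>i\<in>(UNIV::'n set). N * \<epsilon> / d + d * \<epsilon> / 2)"
            by (intro sum_mono)
          also have "\<dots> = A * \<epsilon>" unfolding A_def N_def by (simp add: algebra_simps)
          also have "\<dots> < e" unfolding \<epsilon>_def using A e by simp
          finally have "norm (grad (v l) p) < e"
            using norm_le_l1_cart[of "grad (v l) p"] by linarith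
          then show "dist (grad (w l) p) (grad (\<lambda>x. c\<^sub>0 * \<phi> x) p) < e"
            using grad_v[OF l] p K(2) by (simp add: dist_norm subset_iff)
        qed
      qed
    qed
  qed
  have "\<forall>\<^sub>F l in at_bot. Ck_on 1 \<Omega> (w l)"
    using neg by eventually_elim (rule wC)
  then have "tendsto_C1_loc \<Omega> w (\<lambda>x. c\<^sub>0 * \<phi> x) at_bot"
    unfolding tendsto_C1_loc_def using c\<phi>C val gr by blast
  moreover have "w = (\<lambda>l x. u l x / l)" by (simp add: fun_eq_iff w_def)
  ultimately show ?thesis by simp
qed

end
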